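(* Let $n=1+q$ and let $\rho$ be any complex number. For $n\ge 3$, there is (up to scaling) a unique $K$-invariant spherical function of degree $\rho$ on $S^{1,q}$, given by $$\mathbf{x}\mapsto\int_K (k\mathbf{c}\cdot\mathbf{x})^\rho\,dk ,$$ where $\mathbf{c}$ is any non-zero isotropic vector in $\mathbf{R}^{1,q}$ (isotropic meaning $|\mathbf{c}|^2=0$).
   Context: $\mathbf{R}^{1,q}$ is the space of real $n$-dimensional vectors, $n=1+q$, with the indefinite scalar product $\mathbf{x}\cdot\mathbf{y}=x_1y_1-\sum_{i=2}^n x_iy_i$; write $|\mathbf{x}|^2=\mathbf{x}\cdot\mathbf{x}$. Let $\mathbf{R}^{1,q}_+=\{\mathbf{x}\in\mathbf{R}^{1,q}:|\mathbf{x}|^2>0\}$, and for $\mathbf{x}\in\mathbf{R}^{1,q}_+$ let $|\mathbf{x}|$ be the positive square root of $|\mathbf{x}|^2$. $S^{1,q}$ is the connected component of $\mathbf{e}=(1,0,\ldots,0)$ in $\{\mathbf{x}:|\mathbf{x}|=1,\ x_1>0\}$. Let $\Delta=\frac{\partial^2}{\partial x_1^2}-\sum_{i=2}^n\frac{\partial^2}{\partial x_i^2}$. $\mathcal{H}_\rho$ is the space of functions $f\in C^2(\mathbf{R}^{1,q}_+)$ with $f(\lambda\mathbf{x})=\lambda^\rho f(\mathbf{x})$ for all $\mathbf{x}\in\mathbf{R}^{1,q}_+$, $\lambda>0$, and $\Delta f=0$. A spherical harmonic of degree $\rho$ on $S^{1,q}$ is the restriction to $S^{1,q}$ of a function in $\mathcal{H}_\rho$.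 $O(1,q)$ is the group of real $n\times n$ matrices preserving the scalar product, $O(1,q)_0$ is the connected component of its identity element, and $K$ is the stabilizer of $\mathbf{e}$ in $O(1,q)_0$; it is isomorphic to $SO(q)$ and is a maximal compact subgroup of $O(1,q)_0$. A function $u$ on $S^{1,q}$ is $K$-invariant if $u(k\mathbf{x})=u(\mathbf{x})$ for all $k\in K$, $\mathbf{x}\in S^{1,q}$. $K$-invariant spherical functions (for $O(1,q)_0$) of degree $\rho$ are the same as $K$-invariant spherical harmonics of degree $\rho$ on $S^{1,q}$. $dk$ denotes Haar measure on the compact group $K$. *)

theory Defs
  imports "HOL-Analysis.Analysis"
begin

text \<open>
  The space \<open>\<R>\<^sup>1\<^sup>,\<^sup>q\<close> is \<^typ>\<open>real ^ 'q option\<close>: \<open>q\<close> is \<open>CARD('q)\<close> and \<open>n = 1 + q\<close> is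
  \<open>CARD('q option)\<close>. The index \<^term>\<open>None\<close> is the first coordinate, which has the positive sign
  in the form; the indices \<^term>\<open>Some i\<close> are the remaining \<open>q\<close> coordinates.
  Functions on a subset of this space are total functions whose values outside the subset
  are irrelevant.
\<close>

definition lprod :: "real ^ 'q::finite option \<Rightarrow> real ^ 'q option \<Rightarrow> real"
  where "lprod x y = x $ None * y $ None - (\<Sum>i\<in>UNIV. x $ Some i * y $ Some i)"

definition isotropic :: "real ^ 'q::finite option \<Rightarrow> bool"
  where "isotropic x \<longleftrightarrow> lprod x x = 0"

definition positive_cone :: "(real ^ 'q::finite option) set"
  where "positive_cone = {x. lprod x x > 0}"

definition lnorm :: "real ^ 'q::finite option \<Rightarrow> real"
  where "lnorm x = sqrt (lprod x x)"

definition base_point :: "real ^ 'q::finite option"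
  where "base_point = axis None 1"

definition hyp_sphere :: "(real ^ 'q::finite option) set"
  where "hyp_sphere =
    connected_component_set {x \<in> positive_cone. lnorm x = 1 \<and> x $ None > 0} base_point"

definition partial_deriv ::
    "'q option \<Rightarrow> (real ^ 'q::finite option \<Rightarrow> complex) \<Rightarrow> real ^ 'q option \<Rightarrow> complex"
  where "partial_deriv i f x = vector_derivative (\<lambda>t. f (x + t *\<^sub>R axis i 1)) (at 0)"

definition wave_op :: "(real ^ 'q::finite option \<Rightarrow> complex) \<Rightarrow> real ^ 'q option \<Rightarrow> complex"
  where "wave_op f x = partial_deriv None (partial_deriv None f) x
    - (\<Sum>i\<in>UNIV. partial_deriv (Some i) (partial_deriv (Some i) f) x)"

text \<open>Twice continuously differentiable in the real sense; meant for open \<open>U\<close>.\<close>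

definition C2_on :: "'a::real_normed_vector set \<Rightarrow> ('a \<Rightarrow> 'b::real_normed_vector) \<Rightarrow> bool"
  where "C2_on U f \<longleftrightarrow>
    (\<exists>(f' :: 'a \<Rightarrow> 'a \<Rightarrow>\<^sub>L 'b) (f'' :: 'a \<Rightarrow> 'a \<Rightarrow>\<^sub>L ('a \<Rightarrow>\<^sub>L 'b)).
      (\<forall>x\<in>U. (f has_derivative blinfun_apply (f' x)) (at x)) \<and>
      (\<forall>x\<in>U. (f' has_derivative blinfun_apply (f'' x)) (at x)) \<and>
      continuous_on U f'')"

definition harmonic_space :: "complex \<Rightarrow> (real ^ 'q::finite option \<Rightarrow> complex) set"
  where "harmonic_space \<rho> = {f. C2_on positive_cone f \<and>
    (\<forall>x\<in>positive_cone. \<forall>l>0. f (l *\<^sub>R x) = of_real l powr \<rho> * f x) \<and>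
    (\<forall>x\<in>positive_cone. wave_op f x = 0)}"

definition spherical_harmonic :: "complex \<Rightarrow> (real ^ 'q::finite option \<Rightarrow> complex) \<Rightarrow> bool"
  where "spherical_harmonic \<rho> u \<longleftrightarrow> (\<exists>f\<in>harmonic_space \<rho>. \<forall>x\<in>hyp_sphere. u x = f x)"

definition lorentz_group :: "(real ^ 'q::finite option ^ 'q option) set"
  where "lorentz_group = {A. \<forall>x y. lprod (A *v x) (A *v y) = lprod x y}"

definition lorentz_group0 :: "(real ^ 'q::finite option ^ 'q option) set"
  where "lorentz_group0 = connected_component_set lorentz_group (mat 1)"

definition stabilizer_K :: "(real ^ 'q::finite option ^ 'q option) set"
  where "stabilizer_K = {k \<in> lorentz_group0. k *v base_point = base_point}"

definition K_invariant :: "(real ^ 'q::finite option \<Rightarrow> complex) \<Rightarrow> bool"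
  where "K_invariant u \<longleftrightarrow> (\<forall>k\<in>stabilizer_K. \<forall>x\<in>hyp_sphere. u (k *v x) = u x)"

definition K_spherical_function :: "complex \<Rightarrow> (real ^ 'q::finite option \<Rightarrow> complex) \<Rightarrow> bool"
  where "K_spherical_function \<rho> u \<longleftrightarrow> spherical_harmonic \<rho> u \<and> K_invariant u"

definition unique_K_spherical_function ::
    "complex \<Rightarrow> (real ^ 'q::finite option \<Rightarrow> complex) \<Rightarrow> bool"
  where "unique_K_spherical_function \<rho> u \<longleftrightarrow>
    K_spherical_function \<rho> u \<and> (\<exists>x\<in>hyp_sphere. u x \<noteq> 0) \<and>
    (\<forall>v. K_spherical_function \<rho> v \<longrightarrow> (\<exists>a. \<forall>x\<in>hyp_sphere. v x = a * u x))"

text \<open>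
  Left Haar measures, of arbitrary normalisation, on a locally compact group \<open>G\<close> of matrices.
  Regularity is automatic, since \<open>G\<close> is second countable.
\<close>

definition haar_measure_on ::
    "(real ^ 'n::finite ^ 'n) set \<Rightarrow> (real ^ 'n ^ 'n) measure \<Rightarrow> bool"
  where "haar_measure_on G \<mu> \<longleftrightarrow>
    sets \<mu> = sets (restrict_space borel G) \<and>
    (\<forall>C. compact C \<and> C \<subseteq> G \<longrightarrow> emeasure \<mu> C < \<infinity>) \<and>
    (\<forall>U. openin (top_of_set G) U \<and> U \<noteq> {} \<longrightarrow> emeasure \<mu> U > 0) \<and>
    (\<forall>g\<in>G. \<forall>A\<in>sets \<mu>. emeasure \<mu> ((\<lambda>k. g ** k) ` A) = emeasure \<mu> A)"

text \<open>
  \<open>(kc \<cdot> x)\<^sup>\<rho>\<close> is written \<open>of_real (lprod (k *v c) x) powr \<rho>\<close>, with the principal branch of the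
  power. For \<open>k\<close> in \<^const>\<open>stabilizer_K\<close>, \<open>x\<close> in \<^const>\<open>hyp_sphere\<close> and isotropic \<open>c \<noteq> 0\<close> the base
  is non-zero and has the sign of \<open>c $ None\<close>, so the branch matters only for the constant
  factor \<open>(-1)\<^sup>\<rho>\<close> when \<open>c $ None < 0\<close>.
\<close>

end

theory Submission
  imports Defs
begin

text \<open>
  Let \<open>c\<close> map a finite measure space to isotropic vectors with constant positive first
  coordinate. On the forward cone \<open>x \<mapsto> \<integral> (c(\<omega>) \<cdot> x)\<^sup>\<rho>\<close> may be differentiated twice under the
  integral, and \<open>\<Delta>\<close> produces the factor \<open>|c(\<omega>)|\<^sup>2 = 0\<close>. Extended by zero to the backward cone
  it is harmonic of degree \<open>\<rho>\<close>, and it is \<open>K\<close>-invariant as soon as \<open>K\<close> acts on the measure space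
  compatibly with \<open>c\<close>. With \<open>K\<close> itself and its Haar measure as the measure space this is the
  integral of the theorem; with a ball and Lebesgue measure it gives the existence
  without any reference to a Haar measure.

  For uniqueness, \<open>K\<close> acts transitively on the spheres of the spatial directions, so a
  \<open>K\<close>-invariant harmonic function is determined by its restriction \<open>g\<close> to a ray \<open>s \<mapsto> e + s e\<^sub>j\<close>.
  This \<open>g\<close> is even and solves a linear second order equation with a singular first order term
  of favourable sign, so that \<open>g(0) = g'(0) = 0\<close> forces \<open>g = 0\<close> by an energy estimate.
\<close>

section \<open>Lorentzian geometry\<close>

text \<open>The second claim of the theorem takes a Haar measure as given and so yields no function
  by itself; existence calls for a concrete finite measure space with a measure-preserving action of
  \<open>K\<close> and an equivariant map to isotropic vectors. Lebesgue measure on a ball qualifies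
  because \<open>K\<close> lies in the Euclidean orthogonal group: \<open>lprod x y\<close> and
  \<open>- (x \<bullet> y)\<close> differ by twice the product of the first coordinates, which
  \<open>K\<close> fixes. Non-triviality holds for every complex \<rho>: at the base point each
  c(\<omega>) has the same scalar product with e, so the integrand is constant there and nothing can
  cancel. This also makes evaluation at e the right normalisation for uniqueness. The condition n >=
  3 makes \<open>K\<close> transitive on spatial spheres, and with it g even. For n = 2 the group
  \<open>K\<close> is trivial, g'(0) = 0 is lost, and the solutions form a two-dimensional
  space.\<close>

lemma sum_option: "(\<Sum>i\<in>UNIV. f (i :: 'q::finite option)) = f None + (\<Sum>i\<in>UNIV. f (Some i))"
  by (simp add: UNIV_option_conv sum.reindex)

definition spatial :: "real ^ 'q::finite option \<Rightarrow> real ^ 'q option"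
  where "spatial x = x - (x $ None) *\<^sub>R base_point"

lemma base_point_nth [simp]: "base_point $ None = 1" "base_point $ Some i = 0"
  by (simp_all add: base_point_def axis_def)

lemma spatial_nth [simp]: "spatial x $ None = 0" "spatial x $ Some i = x $ Some i"
  by (simp_all add: spatial_def)

lemma spatial_decompose: "x = (x $ None) *\<^sub>R base_point + spatial x"
  by (simp add: spatial_def)

lemma lprod_spatial: "lprod x y = x $ None * y $ None - spatial x \<bullet> spatial y"
  by (simp add: lprod_def inner_vec_def sum_option)

lemma inner_spatial: "x \<bullet> y = x $ None * y $ None + spatial x \<bullet> spatial y"
  by (simp add: inner_vec_def sum_option)

lemma lprod_inner: "lprod x y = 2 * (x $ None * y $ None) - x \<bullet> y"
  by (simp add: lprod_spatial inner_spatial[of x y])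

lemma bounded_linear_spatial: "bounded_linear spatial"
  unfolding spatial_def by (intro bounded_linear_intros bounded_linear_vec_nth)

lemma linear_spatial: "linear spatial"
  by (simp add: bounded_linear.linear bounded_linear_spatial)

lemma spatial_linear [simp]:
  "spatial (x + y) = spatial x + spatial y" "spatial (r *\<^sub>R x) = r *\<^sub>R spatial x"
  "spatial base_point = 0" "spatial (spatial x) = spatial x"
  by (simp_all add: spatial_def algebra_simps)

lemma norm_spatial_le: "norm (spatial x) \<le> norm x"
proof -
  have "norm (spatial x) ^ 2 \<le> norm x ^ 2"
    by (simp add: power2_norm_eq_inner inner_spatial[of x x])
  then show ?thesis by (rule power2_le_imp_le) simp
qed

lemma lprod_base_point [simp]: "lprod x base_point = x $ None" "lprod base_point x = x $ None"
  by (simp_all add: lprod_spatial)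

lemma bounded_linear_lprod: "bounded_linear (lprod x)"
  unfolding lprod_inner by (intro bounded_linear_intros bounded_linear_vec_nth)

lemma lprod_linear [simp]:
  "lprod x (y + z) = lprod x y + lprod x z" "lprod x (r *\<^sub>R y) = r * lprod x y"
  "lprod (y + z) x = lprod y x + lprod z x" "lprod (r *\<^sub>R y) x = r * lprod y x"
  by (simp_all add: lprod_inner inner_add_left inner_add_right distrib_left distrib_right right_diff_distrib)

lemma continuous_on_lprod [continuous_intros]:
  "continuous_on S f \<Longrightarrow> continuous_on S g \<Longrightarrow> continuous_on S (\<lambda>x. lprod (f x) (g x))"
  unfolding lprod_inner by (intro continuous_intros)

lemma lprod_self: "lprod x x = (x $ None)\<^sup>2 - (norm (spatial x))\<^sup>2"
  by (simp add: lprod_spatial power2_norm_eq_inner) (simp add: power2_eq_square)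

text \<open>The half of the positive cone that contains e. In this form the gap
  \<open>x $ None - norm (spatial x)\<close> is at hand, and it bounds the products with isotropic
  vectors from below.\<close>

definition forward_cone :: "(real ^ 'q::finite option) set"
  where "forward_cone = {x. norm (spatial x) < x $ None}"

lemma forward_cone_iff: "x \<in> forward_cone \<longleftrightarrow> x \<in> positive_cone \<and> x $ None > 0"
proof -
  have "lprod x x > 0 \<longleftrightarrow> norm (spatial x) < \<bar>x $ None\<bar>"
    unfolding lprod_self using abs_le_square_iff[of "x $ None" "norm (spatial x)"] by (simp add: not_le[symmetric])
  then show ?thesis
    using norm_ge_zero[of "spatial x"] unfolding forward_cone_def positive_cone_def mem_Collect_eq
    by linarith
qed

lemma open_forward_cone: "open forward_cone"
  unfolding forward_cone_def
  by (intro open_Collect_less continuous_intros linear_continuous_on bounded_linear_spatial)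

lemma open_positive_cone: "open positive_cone"
  unfolding positive_cone_def by (intro open_Collect_less continuous_intros)

lemma None_nonzero_positive_cone: "x \<in> positive_cone \<Longrightarrow> x $ None \<noteq> 0"
  by (auto simp: positive_cone_def lprod_self)

text \<open>The upper sheet of the hyperboloid is the graph of sqrt(1 + |y|^2) over the spatial
  hyperplane, hence connected, so passing to the component of e removes nothing.\<close>

lemma hyp_sphere_eq: "(hyp_sphere :: (real ^ 'q::finite option) set) = {x. lprod x x = 1 \<and> x $ None > 0}"
proof -
  let ?H = "{x :: real ^ 'q option. lprod x x = 1 \<and> x $ None > 0}"
  define p :: "real ^ 'q option \<Rightarrow> real ^ 'q option"
    where "p y = sqrt (1 + (norm (spatial y))\<^sup>2) *\<^sub>R base_point + spatial y" for y
  have "p ` UNIV = ?H"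
  proof safe
    fix y
    show "lprod (p y) (p y) = 1"
      by (simp add: p_def lprod_self add_nonneg_nonneg)
    show "0 < p y $ None"
      by (simp add: p_def add_pos_nonneg)
  next
    fix x :: "real ^ 'q option" assume x: "lprod x x = 1" "x $ None > 0"
    have "x $ None = sqrt (1 + (norm (spatial x))\<^sup>2)"
      using x by (intro real_sqrt_unique[symmetric]) (auto simp: lprod_self)
    then have "p x = x"
      unfolding p_def by (metis spatial_decompose)
    then show "x \<in> range p" by (metis rangeI)
  qed
  moreover have "connected (p ` UNIV)"
    unfolding p_def
    by (intro connected_continuous_image continuous_intros linear_continuous_on bounded_linear_spatial connected_UNIV)
  ultimately have "connected ?H" by simp
  moreover have "{x \<in> positive_cone. lnorm x = 1 \<and> x $ None > 0} = ?H"
    by (auto simp: positive_cone_def lnorm_def)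
  moreover have "base_point \<in> ?H" by simp
  ultimately show ?thesis
    unfolding hyp_sphere_def by (simp add: connected_component_eq_self)
qed

lemma hyp_sphere_subset_forward_cone: "hyp_sphere \<subseteq> forward_cone"
  by (auto simp: hyp_sphere_eq forward_cone_iff positive_cone_def)

lemma base_point_in_hyp_sphere: "base_point \<in> hyp_sphere"
  by (simp add: hyp_sphere_eq)

lemma forward_cone_normalize:
  assumes "x \<in> forward_cone"
  shows "(1 / lnorm x) *\<^sub>R x \<in> hyp_sphere" "lnorm x > 0"
proof -
  have "lprod x x > 0" using assms by (simp add: forward_cone_iff positive_cone_def)
  then show "lnorm x > 0" by (simp add: lnorm_def)
  moreover have "lprod x x = lnorm x * lnorm x" using \<open>lprod x x > 0\<close> by (simp add: lnorm_def)
  ultimately show "(1 / lnorm x) *\<^sub>R x \<in> hyp_sphere"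
    using assms by (simp add: hyp_sphere_eq forward_cone_iff)
qed

text \<open>The spatial part of an isotropic vector has norm \<open>c $ None\<close>, so
  Cauchy-Schwarz controls the spatial term. The bounds depend on c through its first coordinate
  alone, hence are uniform over a family in which that coordinate is constant.\<close>

lemma lprod_isotropic_bounds:
  assumes c: "isotropic c" "c $ None > 0"
  shows "c $ None * (x $ None - norm (spatial x)) \<le> lprod c x"
    and "lprod c x \<le> c $ None * (x $ None + norm (spatial x))"
proof -
  have "(norm (spatial c))\<^sup>2 = (c $ None)\<^sup>2"
    using c by (simp add: isotropic_def lprod_self)
  then have "norm (spatial c) = c $ None"
    using c by (simp add: power2_eq_iff_nonneg)
  then have "\<bar>spatial c \<bullet> spatial x\<bar> \<le> c $ None * norm (spatial x)"
    by (metis Cauchy_Schwarz_ineq2)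
  then show "c $ None * (x $ None - norm (spatial x)) \<le> lprod c x"
    and "lprod c x \<le> c $ None * (x $ None + norm (spatial x))"
    by (auto simp: lprod_spatial algebra_simps)
qed

lemma isotropic_None_nonzero: "isotropic c \<Longrightarrow> c \<noteq> 0 \<Longrightarrow> c $ None \<noteq> 0"
proof
  assume "isotropic c" "c \<noteq> 0" "c $ None = 0"
  then have "spatial c = 0" by (simp add: isotropic_def lprod_spatial)
  then show False using \<open>c \<noteq> 0\<close> \<open>c $ None = 0\<close> spatial_decompose[of c] by simp
qed

section \<open>The stabilizer of the base point\<close>

lemma mat1_in_lorentz: "mat 1 \<in> lorentz_group"
  by (simp add: lorentz_group_def)

lemma stabilizer_lprod: "k \<in> stabilizer_K \<Longrightarrow> lprod (k *v x) (k *v y) = lprod x y"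
  unfolding stabilizer_K_def lorentz_group0_def
  using connected_component_subset[of lorentz_group] by (auto simp: lorentz_group_def)

lemma stabilizer_base_point: "k \<in> stabilizer_K \<Longrightarrow> k *v base_point = base_point"
  by (simp add: stabilizer_K_def)

lemma stabilizer_None: "k \<in> stabilizer_K \<Longrightarrow> (k *v x) $ None = x $ None"
  by (metis stabilizer_lprod stabilizer_base_point lprod_base_point(1))

text \<open>The Lorentzian and the Euclidean product determine each other once the first coordinates
  are known, and \<open>k\<close> preserves these. Compactness of \<open>K\<close> and the
  invariance of Lebesgue measure both rest on this.\<close>

lemma stabilizer_orthogonal: "k \<in> stabilizer_K \<Longrightarrow> orthogonal_transformation ((*v) k)"
  unfolding orthogonal_transformation_def
proof safe
  fix x y assume k: "k \<in> stabilizer_K"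
  show "(k *v x) \<bullet> (k *v y) = x \<bullet> y"
    using stabilizer_lprod[OF k, of x y] by (simp add: lprod_inner stabilizer_None[OF k])
qed simp

lemma stabilizer_spatial: "k \<in> stabilizer_K \<Longrightarrow> spatial (k *v x) = k *v spatial x"
  by (simp add: spatial_def stabilizer_None matrix_vector_mult_diff_distrib
      matrix_vector_mult_scaleR stabilizer_base_point)

lemma stabilizer_hyp_sphere: "k \<in> stabilizer_K \<Longrightarrow> x \<in> hyp_sphere \<Longrightarrow> k *v x \<in> hyp_sphere"
  by (simp add: hyp_sphere_eq stabilizer_lprod stabilizer_None)

text \<open>Multiplication is continuous on the product of two connected sets through the identity,
  so the products form a connected subset of the group that again contains the identity.\<close>

lemma lorentz_component_mult:
  assumes "S \<subseteq> lorentz_group" "connected S" "mat 1 \<in> S" "A \<in> S" "B \<in> lorentz_group0"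
  shows "A ** B \<in> lorentz_group0"
proof -
  let ?C = "lorentz_group0 :: (real ^ 'a option ^ 'a option) set"
  have C: "connected ?C" "mat 1 \<in> ?C" "?C \<subseteq> lorentz_group"
    by (auto simp: lorentz_group0_def connected_connected_component mat1_in_lorentz connected_component_in
        dest!: connected_component_in)
  have "continuous_on (S \<times> ?C) (\<lambda>p. fst p ** snd p)"
    unfolding matrix_matrix_mult_def by (intro continuous_intros continuous_on_vec_lambda)
  then have "connected ((\<lambda>p. fst p ** snd p) ` (S \<times> ?C))"
    by (intro connected_continuous_image connected_Times assms C)
  moreover have "(\<lambda>p. fst p ** snd p) ` (S \<times> ?C) \<subseteq> lorentz_group"
    using assms(1) C by (auto simp: lorentz_group_def subset_iff simp flip: matrix_vector_mul_assoc)
  moreover have "mat 1 \<in> (\<lambda>p. fst p ** snd p) ` (S \<times> ?C)"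
    using assms(3) C by (force intro: image_eqI[where x="(mat 1, mat 1)"])
  ultimately have "(\<lambda>p. fst p ** snd p) ` (S \<times> ?C) \<subseteq> ?C"
    unfolding lorentz_group0_def by (intro connected_component_maximal)
  then show ?thesis using assms by force
qed

lemma mat1_in_lorentz_group0: "mat 1 \<in> lorentz_group0"
  by (simp add: lorentz_group0_def mat1_in_lorentz)

lemma lorentz_group0_subset: "lorentz_group0 \<subseteq> lorentz_group"
  by (simp add: lorentz_group0_def connected_component_subset)

lemma connected_lorentz_group0: "connected lorentz_group0"
  by (simp add: lorentz_group0_def)

lemma stabilizer_mult:
  assumes "k \<in> stabilizer_K" "k' \<in> stabilizer_K"
  shows "k ** k' \<in> stabilizer_K"
proof -
  have "k ** k' \<in> lorentz_group0"
    using assms by (intro lorentz_component_mult[OF lorentz_group0_subset connected_lorentz_group0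
          mat1_in_lorentz_group0]) (simp_all add: stabilizer_K_def)
  then show ?thesis
    using assms by (simp add: stabilizer_K_def flip: matrix_vector_mul_assoc)
qed

lemma mat1_in_stabilizer: "mat 1 \<in> stabilizer_K"
  by (simp add: stabilizer_K_def mat1_in_lorentz_group0)

lemma stabilizer_transpose:
  assumes k: "k \<in> stabilizer_K"
  shows "transpose k \<in> stabilizer_K" "transpose k ** k = mat 1" "k ** transpose k = mat 1"
proof -
  have "orthogonal_matrix k"
    using stabilizer_orthogonal[OF k] by (simp add: orthogonal_transformation_matrix)
  then show inv: "transpose k ** k = mat 1" "k ** transpose k = mat 1"
    by (simp_all add: orthogonal_matrix_def)
  have pres: "lprod (transpose k *v x) (transpose k *v y) = lprod x y" for x y
    using stabilizer_lprod[OF k, of "transpose k *v x" "transpose k *v y"]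
    by (simp add: matrix_vector_mul_assoc inv del: transpose_matrix_vector)
  \<comment> \<open>A translate of the identity component is connected, and this one contains both
    the identity, as \<open>transpose k ** k\<close>, and \<open>transpose k\<close> itself; so it
    stays inside the component.\<close>
  let ?S = "(\<lambda>B. transpose k ** B) ` lorentz_group0"
  have "?S \<subseteq> lorentz_group"
    using lorentz_group0_subset by (auto simp: lorentz_group_def pres subset_iff
        simp del: transpose_matrix_vector simp flip: matrix_vector_mul_assoc)
  moreover have "connected ?S"
    unfolding matrix_matrix_mult_def
    by (intro connected_continuous_image continuous_intros continuous_on_vec_lambda connected_lorentz_group0)
  moreover have "mat 1 \<in> ?S"
    using k inv by (auto simp: stabilizer_K_def intro!: image_eqI[where x=k])
  ultimately have "?S \<subseteq> lorentz_group0"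
    unfolding lorentz_group0_def by (intro connected_component_maximal)
  moreover have "transpose k \<in> ?S"
    using mat1_in_lorentz_group0 by (metis image_eqI matrix_mul_rid)
  moreover have "transpose k *v base_point = base_point"
    using inv(1) stabilizer_base_point[OF k] by (metis matrix_vector_mul_assoc matrix_vector_mul_lid)
  ultimately show "transpose k \<in> stabilizer_K"
    by (auto simp: stabilizer_K_def)
qed

lemma continuous_on_matrix_vector [continuous_intros]:
  fixes A :: "'b::topological_space \<Rightarrow> real ^ 'n::finite ^ 'm::finite"
  shows "continuous_on S A \<Longrightarrow> continuous_on S (\<lambda>t. A t *v x)"
  unfolding matrix_vector_mult_def by (intro continuous_intros continuous_on_vec_lambda)

text \<open>A component is closed in the closed group, and fixing e is a closed condition. The
  columns of an orthogonal matrix are unit vectors, which bounds every entry by 1. Compactness is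
  what makes a Haar measure on \<open>K\<close> finite.\<close>

lemma compact_stabilizer: "compact (stabilizer_K :: (real ^ 'q::finite option ^ 'q option) set)"
proof -
  let ?K = "stabilizer_K :: (real ^ 'q::finite option ^ 'q option) set"
  have "closed (lorentz_group :: (real ^ 'q::finite option ^ 'q option) set)"
    unfolding lorentz_group_def
    by (intro closed_Collect_all closed_Collect_eq continuous_intros)
  then have "closed (lorentz_group0 :: (real ^ 'q::finite option ^ 'q option) set)"
    unfolding lorentz_group0_def using closedin_connected_component closedin_closed_trans by blast
  moreover have "?K = lorentz_group0 \<inter> {k. k *v base_point = base_point}"
    by (auto simp: stabilizer_K_def)
  moreover have "closed {k :: real ^ 'q option ^ 'q option. k *v base_point = base_point}"
    by (intro closed_Collect_eq continuous_intros)
  ultimately have "closed ?K"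
    by (metis closed_Int)
  moreover have "norm k \<le> (\<Sum>i\<in>(UNIV :: 'q option set). \<Sum>j\<in>(UNIV :: 'q option set). 1)"
    if k: "k \<in> ?K" for k
  proof -
    have "\<bar>k $ i $ j\<bar> \<le> 1" for i j
    proof -
      have "k $ i $ j = (k *v axis j 1) $ i" by (simp add: matrix_vector_mult_basis column_def)
      also have "\<bar>\<dots>\<bar> \<le> norm (k *v axis j 1)" by (rule component_le_norm_cart)
      also have "\<dots> = 1"
        using orthogonal_transformation_norm[OF stabilizer_orthogonal[OF k]] by simp
      finally show ?thesis .
    qed
    then have "norm (k $ i) \<le> (\<Sum>j\<in>(UNIV :: 'q option set). 1)" for i
      by (intro order_trans[OF norm_le_l1_cart] sum_mono)
    then show ?thesis
      unfolding norm_vec_def[of k] by (intro order_trans[OF L2_set_le_sum] sum_mono) auto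
  qed
  then have "bounded ?K" by (auto simp: bounded_iff)
  ultimately show ?thesis by (simp add: compact_eq_bounded_closed)
qed

text \<open>For orthonormal u and w this sends u to cos \<theta> u + sin \<theta> w, w to - sin
  \<theta> u + cos \<theta> w, and fixes the orthogonal complement of the plane. The formula is
  continuous in \<theta> and is the identity at \<theta> = 0.\<close>

definition plane_rotation :: "'a::real_inner \<Rightarrow> 'a \<Rightarrow> real \<Rightarrow> 'a \<Rightarrow> 'a"
  where "plane_rotation u w \<theta> x = x
    + ((cos \<theta> - 1) * (x \<bullet> u) - sin \<theta> * (x \<bullet> w)) *\<^sub>R u
    + (sin \<theta> * (x \<bullet> u) + (cos \<theta> - 1) * (x \<bullet> w)) *\<^sub>R w"

lemma linear_plane_rotation: "linear (plane_rotation u w \<theta>)"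
  by (rule linearI) (simp_all add: plane_rotation_def inner_add_left algebra_simps)

lemma inner_plane_rotation:
  assumes "norm u = 1" "norm w = 1" "u \<bullet> w = 0"
  shows "plane_rotation u w \<theta> x \<bullet> plane_rotation u w \<theta> y = x \<bullet> y"
proof -
  define a b a' b' c s where d: "a = x \<bullet> u" "b = x \<bullet> w" "a' = y \<bullet> u" "b' = y \<bullet> w"
    "c = cos \<theta>" "s = sin \<theta>"
  have uw: "u \<bullet> u = 1" "w \<bullet> w = 1" "w \<bullet> u = 0" "u \<bullet> w = 0" "u \<bullet> y = a'" "w \<bullet> y = b'"
    using assms by (simp_all add: norm_eq_1 inner_commute d)
  have "plane_rotation u w \<theta> x \<bullet> plane_rotation u w \<theta> y
      = x \<bullet> y + (c\<^sup>2 + s\<^sup>2 - 1) * (a * a' + b * b')"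
    unfolding plane_rotation_def d(5,6)[symmetric] d(1-4)[symmetric] inner_add_left inner_add_right
      inner_scaleR_left inner_scaleR_right uw d(1-4)[symmetric] power2_eq_square
    by algebra
  then show ?thesis by (simp add: d)
qed

text \<open>All angles together form a connected family through the identity, which places each
  rotation in the identity component; e is orthogonal to the plane and therefore fixed.\<close>

lemma plane_rotation_in_stabilizer:
  fixes u w :: "real ^ 'q::finite option"
  assumes "norm u = 1" "norm w = 1" "u \<bullet> w = 0" "u $ None = 0" "w $ None = 0"
  shows "matrix (plane_rotation u w \<theta>) \<in> stabilizer_K"
proof -
  let ?R = "\<lambda>\<theta>. matrix (plane_rotation u w \<theta>)"
  have R: "?R \<theta> *v x = plane_rotation u w \<theta> x" for \<theta> x
    by (simp add: matrix_works linear_plane_rotation)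
  have "?R \<theta> \<in> lorentz_group" for \<theta>
    using assms by (simp add: lorentz_group_def R lprod_inner inner_plane_rotation)
      (simp add: plane_rotation_def)
  moreover have "connected (range ?R)"
    unfolding matrix_def plane_rotation_def
    by (intro connected_continuous_image continuous_intros continuous_on_vec_lambda connected_UNIV)
  moreover have "mat 1 \<in> range ?R"
  proof (rule image_eqI)
    have "plane_rotation u w 0 = id" by (simp add: plane_rotation_def fun_eq_iff)
    then show "mat 1 = ?R 0" by (simp add: matrix_id_mat_1)
  qed simp
  ultimately have "range ?R \<subseteq> lorentz_group0"
    unfolding lorentz_group0_def by (intro connected_component_maximal) auto
  moreover have "base_point \<bullet> u = 0" "base_point \<bullet> w = 0"
    using assms by (simp_all add: base_point_def inner_axis')
  ultimately show ?thesis
    by (auto simp: stabilizer_K_def R) (simp add: plane_rotation_def)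
qed

text \<open>A single rotation suffices, in the plane of the two normalised vectors u and v. If v is
  a multiple of u, any spatial unit vector orthogonal to u completes the plane.\<close>

lemma stabilizer_transitive:
  fixes x y :: "real ^ 'q::finite option"
  assumes n: "CARD('q option) \<ge> 3" and "x $ None = 0" "y $ None = 0" and xy: "norm x = norm y"
  obtains k where "k \<in> stabilizer_K" "k *v x = y"
proof (cases "x = 0")
  case True
  then show ?thesis using xy that[OF mat1_in_stabilizer] by simp
next
  case False
  define r u v where ruv: "r = norm x" "u = x /\<^sub>R r" "v = y /\<^sub>R r"
  have r: "r > 0" and uv: "norm u = 1" "norm v = 1" "u $ None = 0" "v $ None = 0" "x = r *\<^sub>R u" "y = r *\<^sub>R v"
    using False assms by (auto simp: ruv simp flip: xy)
  define d where "d = v - (v \<bullet> u) *\<^sub>R u"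
  have du: "d \<bullet> u = 0" "d $ None = 0"
    using uv by (simp_all add: d_def inner_diff_left norm_eq_1)
  have "\<exists>w. norm w = 1 \<and> u \<bullet> w = 0 \<and> w $ None = 0 \<and> d = norm d *\<^sub>R w"
  proof (cases "d = 0")
    case False
    then show ?thesis using du by (intro exI[of _ "d /\<^sub>R norm d"]) (simp add: inner_commute)
  next
    case True
    \<comment> \<open>This is where n >= 3 enters: u and e span at most two dimensions, which leaves
      room for a direction orthogonal to both.\<close>
    have "dim {u, base_point} \<le> card {u, base_point}"
      by (intro dim_le_card') simp
    also have "\<dots> < DIM(real ^ 'q option)"
      using n card_insert_le_m1[of 2 "{base_point}" u] by (simp add: card_insert_if)
    finally obtain w where w: "w \<noteq> 0" "\<And>y. y \<in> span {u, base_point} \<Longrightarrow> orthogonal w y"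
      using orthogonal_to_subspace_exists by metis
    have "w \<bullet> u = 0" "w \<bullet> base_point = 0"
      using w(2) by (auto simp: orthogonal_def span_base)
    then show ?thesis using True w(1)
      by (intro exI[of _ "w /\<^sub>R norm w"]) (simp add: inner_commute base_point_def inner_axis)
  qed
  then obtain w where w: "norm w = 1" "u \<bullet> w = 0" "w $ None = 0" "d = norm d *\<^sub>R w" by blast
  have v: "v = (v \<bullet> u) *\<^sub>R u + norm d *\<^sub>R w"
    using w(4) by (simp add: d_def algebra_simps)
  have "v \<bullet> v = (v \<bullet> u)\<^sup>2 + (norm d)\<^sup>2"
    using uv du by (simp add: d_def power2_norm_eq_inner norm_eq_1 inner_diff_left inner_diff_right
        inner_commute) (simp add: power2_eq_square)
  then have "(v \<bullet> u)\<^sup>2 + (norm d)\<^sup>2 = 1"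
    using uv by (simp add: norm_eq_1)
  \<comment> \<open>The pair of \<open>v \<bullet> u\<close> and \<open>norm d\<close> is the
    coordinate vector of v in the orthonormal frame u, w, hence a point of the unit circle.\<close>
  then obtain \<theta> where \<theta>: "v \<bullet> u = cos \<theta>" "norm d = sin \<theta>"
    by (metis sincos_total_2pi)
  let ?k = "matrix (plane_rotation u w \<theta>)"
  have "?k *v u = v"
    using uv w v unfolding \<theta>
    by (simp add: matrix_works linear_plane_rotation) (simp add: plane_rotation_def norm_eq_1 algebra_simps)
  then have "?k *v x = y" by (simp add: uv matrix_vector_mult_scaleR)
  then show ?thesis using that plane_rotation_in_stabilizer[of u w] uv w by blast
qed

section \<open>Partial derivatives\<close>

text \<open>\<open>C2_on\<close> asks for operator-valued derivatives. This operator depends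
  linearly and boundedly on \<open>v\<close>, so derivatives and continuity of partial derivatives
  carry over to the operators assembled from them.\<close>

definition coord_blinfun :: "'n::finite \<Rightarrow> 'b::real_normed_vector \<Rightarrow> (real ^ 'n) \<Rightarrow>\<^sub>L 'b"
  where "coord_blinfun i v = blinfun_scaleR_left v o\<^sub>L Blinfun (\<lambda>h. h $ i)"

lemma coord_blinfun_apply [simp]: "blinfun_apply (coord_blinfun i v) h = h $ i *\<^sub>R v"
  by (simp add: coord_blinfun_def bounded_linear_Blinfun_apply bounded_linear_vec_nth)

lemma bounded_linear_coord_blinfun: "bounded_linear (coord_blinfun i)"
  unfolding coord_blinfun_def
  by (intro bounded_linear_compose[OF bounded_bilinear.bounded_linear_left[OF bounded_bilinear_blinfun_compose]]
      bounded_linear_blinfun_scaleR_left)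

lemma C2_on_partials:
  fixes f :: "real ^ 'n::finite \<Rightarrow> 'b::real_normed_vector"
  assumes f: "\<And>x. x \<in> U \<Longrightarrow> (f has_derivative (\<lambda>h. \<Sum>i\<in>UNIV. h $ i *\<^sub>R p i x)) (at x)"
    and p: "\<And>i x. x \<in> U \<Longrightarrow> (p i has_derivative (\<lambda>h. \<Sum>j\<in>UNIV. h $ j *\<^sub>R r i j x)) (at x)"
    and r: "\<And>i j. continuous_on U (r i j)"
  shows "C2_on U f"
  unfolding C2_on_def
proof (intro exI conjI ballI)
  let ?f' = "\<lambda>x. \<Sum>i\<in>UNIV. coord_blinfun i (p i x)"
  let ?f'' = "\<lambda>x. \<Sum>i\<in>UNIV. \<Sum>j\<in>UNIV. coord_blinfun j (coord_blinfun i (r i j x))"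
  fix x assume x: "x \<in> U"
  show "(f has_derivative blinfun_apply (?f' x)) (at x)"
  proof -
    have "blinfun_apply (?f' x) = (\<lambda>h. \<Sum>i\<in>UNIV. h $ i *\<^sub>R p i x)"
      by (rule ext) (simp add: blinfun.sum_left)
    then show ?thesis using f[OF x] by simp
  qed
  have "(?f' has_derivative (\<lambda>h. \<Sum>i\<in>UNIV. coord_blinfun i (\<Sum>j\<in>UNIV. h $ j *\<^sub>R r i j x))) (at x)"
    by (intro has_derivative_sum bounded_linear.has_derivative[OF bounded_linear_coord_blinfun] p x)
  moreover have "blinfun_apply (?f'' x)
      = (\<lambda>h. \<Sum>i\<in>UNIV. coord_blinfun i (\<Sum>j\<in>UNIV. h $ j *\<^sub>R r i j x))"
    by (rule ext) (simp add: blinfun.sum_left linear_sum[OF bounded_linear.linear[OF bounded_linear_coord_blinfun]]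
        linear_scale[OF bounded_linear.linear[OF bounded_linear_coord_blinfun]])
  ultimately show "(?f' has_derivative blinfun_apply (?f'' x)) (at x)" by simp
next
  show "continuous_on U (\<lambda>x. \<Sum>i\<in>UNIV. \<Sum>j\<in>UNIV. coord_blinfun j (coord_blinfun i (r i j x)))"
    by (intro continuous_on_sum bounded_linear.continuous_on[OF bounded_linear_coord_blinfun] r)
qed

lemma has_vector_derivative_along_axis:
  fixes f :: "real ^ 'n::finite \<Rightarrow> 'b::real_normed_vector"
  assumes "(f has_derivative f') (at x)"
  shows "((\<lambda>t. f (x + t *\<^sub>R axis i 1)) has_vector_derivative f' (axis i 1)) (at 0)"
proof -
  have f': "((\<lambda>y. f y) has_derivative f') (at (x + 0 *\<^sub>R axis i 1))"
    using assms by simp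
  have "((\<lambda>t. x + t *\<^sub>R axis i 1) has_derivative (\<lambda>t. t *\<^sub>R axis i 1)) (at 0)"
    by (auto intro!: derivative_eq_intros)
  from has_derivative_compose[OF this f'] show ?thesis
    unfolding has_vector_derivative_def
    by (simp add: linear_scale[OF has_derivative_linear[OF assms]])
qed

lemma partial_deriv_eq:
  assumes "(f has_derivative (\<lambda>h. \<Sum>i\<in>UNIV. h $ i *\<^sub>R p i)) (at x)"
  shows "partial_deriv i f x = p i"
proof -
  have "(\<Sum>j\<in>UNIV. axis i (1::real) $ j *\<^sub>R p j) = (\<Sum>j\<in>UNIV. if j = i then p j else 0)"
    by (intro sum.cong) (auto simp: axis_def)
  then show ?thesis
    unfolding partial_deriv_def
    using vector_derivative_at[OF has_vector_derivative_along_axis[OF assms, of i]] by simp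
qed

text \<open>An iterated partial derivative differentiates \<open>partial_deriv i f\<close>, which is
  known explicitly only on an open set; openness is enough since only values near x matter.\<close>

lemma partial_deriv_cong:
  assumes "open U" "x \<in> U" "\<And>y. y \<in> U \<Longrightarrow> f y = g y"
  shows "partial_deriv i f x = partial_deriv i g x"
proof -
  have "isCont (\<lambda>t. x + t *\<^sub>R axis i 1) 0" by (intro continuous_intros)
  then have "((\<lambda>t::real. x + t *\<^sub>R axis i 1) \<longlongrightarrow> x) (nhds 0)"
    by (simp add: isCont_def tendsto_nhds_iff)
  then have "\<forall>\<^sub>F t in nhds (0::real). x + t *\<^sub>R axis i 1 \<in> U"
    using assms(1,2) topological_tendstoD by blast
  then have "\<forall>\<^sub>F t in nhds 0. f (x + t *\<^sub>R axis i 1) = g (x + t *\<^sub>R axis i 1)"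
    by (rule eventually_mono) (simp add: assms(3))
  then show ?thesis
    unfolding partial_deriv_def by (intro vector_derivative_cong_eq) auto
qed

lemma wave_op_eq:
  assumes U: "open U" "x \<in> U"
    and f: "\<And>x. x \<in> U \<Longrightarrow> (f has_derivative (\<lambda>h. \<Sum>i\<in>UNIV. h $ i *\<^sub>R p i x)) (at x)"
    and p: "\<And>i x. x \<in> U \<Longrightarrow> (p i has_derivative (\<lambda>h. \<Sum>j\<in>UNIV. h $ j *\<^sub>R r i j x)) (at x)"
  shows "wave_op f x = r None None x - (\<Sum>i\<in>UNIV. r (Some i) (Some i) x)"
proof -
  have "partial_deriv i (partial_deriv i f) x = r i i x" for i
  proof -
    have "partial_deriv i (partial_deriv i f) x = partial_deriv i (p i) x"
      by (intro partial_deriv_cong[OF U] partial_deriv_eq f)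
    also have "\<dots> = r i i x"
      by (intro partial_deriv_eq p U)
    finally show ?thesis .
  qed
  then show ?thesis by (simp add: wave_op_def)
qed

section \<open>Complex powers of a positive real variable\<close>

lemma of_real_powr_exp: "t > 0 \<Longrightarrow> (of_real t :: complex) powr \<sigma> = exp (\<sigma> * of_real (ln t))"
  by (simp add: powr_def Ln_of_real)

lemma of_real_powr_has_vector_derivative:
  assumes "t > 0"
  shows "((\<lambda>t. (of_real t :: complex) powr \<sigma>) has_vector_derivative \<sigma> * of_real t powr (\<sigma> - 1)) (at t)"
proof -
  have "((\<lambda>z::complex. z powr \<sigma>) has_field_derivative \<sigma> * of_real t powr (\<sigma> - 1)) (at (of_real t))"
    using assms by (intro has_field_derivative_powr) (simp add: complex_nonpos_Reals_iff)
  from has_vector_derivative_real_field[OF this] show ?thesis by simp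
qed

lemma of_real_powr_bounded:
  assumes "0 < a"
  obtains B where "\<And>t. t \<in> {a..b} \<Longrightarrow> norm ((of_real t :: complex) powr \<sigma>) \<le> B" "B \<ge> 0"
proof -
  have "continuous_on {a..b} (\<lambda>t. (of_real t :: complex) powr \<sigma>)"
    using assms
    by (intro continuous_at_imp_continuous_on ballI
        has_vector_derivative_continuous[OF of_real_powr_has_vector_derivative]) auto
  then have "bounded ((\<lambda>t. (of_real t :: complex) powr \<sigma>) ` {a..b})"
    by (intro compact_imp_bounded compact_continuous_image) auto
  then obtain B where "\<forall>t\<in>{a..b}. norm ((of_real t :: complex) powr \<sigma>) \<le> B"
    by (auto simp: bounded_iff)
  then show ?thesis by (intro that[of "max B 0"]) (auto simp: le_max_iff_disj)
qed

text \<open>The second derivative is bounded on a compact interval away from 0. One constant serves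
  all s and t, so the remainder can be integrated over a family of base values.\<close>

lemma of_real_powr_Taylor:
  assumes "0 < a"
  obtains C where "C \<ge> 0" "\<And>s t. s \<in> {a..b} \<Longrightarrow> t \<in> {a..b} \<Longrightarrow>
    norm ((of_real t :: complex) powr \<sigma> - of_real s powr \<sigma> - \<sigma> * of_real s powr (\<sigma> - 1) * of_real (t - s))
      \<le> C * (t - s)\<^sup>2"
proof -
  obtain B where B: "\<And>t. t \<in> {a..b} \<Longrightarrow> norm ((of_real t :: complex) powr (\<sigma> - 2)) \<le> B" "B \<ge> 0"
    using of_real_powr_bounded[OF assms] by blast
  define C where "C = norm (\<sigma> * (\<sigma> - 1)) * B"
  define g where "g i z = (if i = 0 then z powr \<sigma> else if i = 1 then \<sigma> * z powr (\<sigma> - 1)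
    else \<sigma> * (\<sigma> - 1) * z powr (\<sigma> - 2))" for i :: nat and z :: complex
  have "norm ((of_real t :: complex) powr \<sigma> - of_real s powr \<sigma> - \<sigma> * of_real s powr (\<sigma> - 1) * of_real (t - s))
      \<le> C * (t - s)\<^sup>2" if st: "s \<in> {a..b}" "t \<in> {a..b}" for s t
  proof -
    have "norm (g 0 (of_real t) - (\<Sum>i\<le>1. g i (of_real s) * (of_real t - of_real s) ^ i / fact i))
      \<le> C * norm (of_real t - of_real s :: complex) ^ Suc 1 / fact 1"
    proof (rule field_Taylor[where S = "of_real ` {a..b}"])
      show "convex (of_real ` {a..b} :: complex set)"
        by (intro convex_linear_image linear_of_real) auto
      fix i :: nat and z :: complex assume "z \<in> of_real ` {a..b}" "i \<le> 1"
      then obtain v where v: "z = of_real v" "v \<ge> a" by auto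
      then have z: "z \<notin> \<real>\<^sub>\<le>\<^sub>0" using assms by (simp add: complex_nonpos_Reals_iff)
      have "((\<lambda>z. z powr \<sigma>) has_field_derivative \<sigma> * z powr (\<sigma> - 1)) (at z)"
        by (intro has_field_derivative_powr z)
      moreover have "((\<lambda>z. \<sigma> * z powr (\<sigma> - 1)) has_field_derivative \<sigma> * ((\<sigma> - 1) * z powr (\<sigma> - 1 - 1))) (at z)"
        by (intro DERIV_cmult has_field_derivative_powr z)
      ultimately show "(g i has_field_derivative g (Suc i) z) (at z within of_real ` {a..b})"
        using \<open>i \<le> 1\<close> unfolding g_def [abs_def]
        by (cases i) (auto intro: has_field_derivative_at_within simp: algebra_simps)
    next
      fix z :: complex assume "z \<in> of_real ` {a..b}"
      then show "norm (g (Suc 1) z) \<le> C"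
        using B by (auto simp: g_def C_def norm_mult intro!: mult_left_mono)
    qed (use st in auto)
    moreover have "norm (of_real t - of_real s :: complex) ^ Suc 1 = (t - s)\<^sup>2"
      by (simp add: power2_eq_square flip: of_real_diff)
    ultimately show ?thesis by (simp add: g_def diff_diff_eq flip: of_real_diff)
  qed
  moreover have "C \<ge> 0" using B by (simp add: C_def)
  ultimately show ?thesis using that by blast
qed

section \<open>Integrals of powers over families of isotropic vectors\<close>

locale isotropic_family = finite_measure M for M :: "'w measure" +
  fixes c :: "'w \<Rightarrow> real ^ 'q::finite option" and \<gamma> :: real
  assumes c_measurable [measurable]: "c \<in> borel_measurable M"
    and c_isotropic: "\<omega> \<in> space M \<Longrightarrow> isotropic (c \<omega>)"
    and c_None: "\<omega> \<in> space M \<Longrightarrow> c \<omega> $ None = \<gamma>"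
    and \<gamma>_pos: "\<gamma> > 0"
begin

text \<open>The weight \<phi> makes the class closed under differentiation: a derivative along axis
  i lowers the exponent by one and multiplies the weight by \<sigma> times the product of
  c(\<omega>) with that axis vector.\<close>

definition powr_integral :: "('w \<Rightarrow> complex) \<Rightarrow> complex \<Rightarrow> real ^ 'q option \<Rightarrow> complex"
  where "powr_integral \<phi> \<sigma> x = (\<integral>\<omega>. \<phi> \<omega> * of_real (lprod (c \<omega>) x) powr \<sigma> \<partial>M)"

definition bounded_weight :: "('w \<Rightarrow> complex) \<Rightarrow> bool"
  where "bounded_weight \<phi> \<longleftrightarrow> \<phi> \<in> borel_measurable M \<and> (\<exists>B. \<forall>\<omega>\<in>space M. norm (\<phi> \<omega>) \<le> B)"

lemma bounded_weightI:
  "\<phi> \<in> borel_measurable M \<Longrightarrow> (\<And>\<omega>. \<omega> \<in> space M \<Longrightarrow> norm (\<phi> \<omega>) \<le> B) \<Longrightarrow> bounded_weight \<phi>"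
  by (auto simp: bounded_weight_def)

lemma bounded_weight_integrable: "bounded_weight \<phi> \<Longrightarrow> integrable M \<phi>"
  by (auto simp: bounded_weight_def intro: integrable_const_bound)

lemma bounded_weight_mult:
  assumes "bounded_weight \<phi>" "bounded_weight \<psi>"
  shows "bounded_weight (\<lambda>\<omega>. \<phi> \<omega> * \<psi> \<omega>)"
proof -
  obtain A B where "\<And>\<omega>. \<omega> \<in> space M \<Longrightarrow> norm (\<phi> \<omega>) \<le> A" "\<And>\<omega>. \<omega> \<in> space M \<Longrightarrow> norm (\<psi> \<omega>) \<le> B"
    using assms by (auto simp: bounded_weight_def)
  then have "norm (\<phi> \<omega> * \<psi> \<omega>) \<le> A * B" if "\<omega> \<in> space M" for \<omega>
    using that unfolding norm_mult by (meson mult_mono norm_ge_zero order_trans)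
  moreover have "(\<lambda>\<omega>. \<phi> \<omega> * \<psi> \<omega>) \<in> borel_measurable M"
    using assms by (auto simp: bounded_weight_def)
  ultimately show ?thesis by (rule bounded_weightI[rotated])
qed

lemma bounded_weight_const: "bounded_weight (\<lambda>_. a)"
  by (auto simp: bounded_weight_def)

lemma norm_c: "\<omega> \<in> space M \<Longrightarrow> norm (c \<omega>) \<le> 2 * \<gamma>"
proof -
  assume \<omega>: "\<omega> \<in> space M"
  have "(norm (spatial (c \<omega>)))\<^sup>2 = \<gamma>\<^sup>2"
    using c_isotropic[OF \<omega>] c_None[OF \<omega>] by (simp add: isotropic_def lprod_self)
  then have "(norm (c \<omega>))\<^sup>2 \<le> (2 * \<gamma>)\<^sup>2"
    by (simp add: power2_norm_eq_inner inner_spatial[of "c \<omega>" "c \<omega>"] c_None \<omega>) (simp add: power2_eq_square)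
  then show ?thesis by (rule power2_le_imp_le) (use \<gamma>_pos in simp)
qed

text \<open>The form is twice the product of the first coordinates minus the Euclidean product, so
  it is at most 3 |c| |x|; the crude estimate |c| \<le> 2 \<gamma> (exactly, |c| is sqrt 2 times
  \<gamma>) gives the 6.\<close>

lemma lprod_c_bound: "\<omega> \<in> space M \<Longrightarrow> \<bar>lprod (c \<omega>) x\<bar> \<le> 6 * \<gamma> * norm x"
proof -
  assume \<omega>: "\<omega> \<in> space M"
  have "\<bar>lprod (c \<omega>) x\<bar> \<le> 2 * (\<bar>c \<omega> $ None\<bar> * \<bar>x $ None\<bar>) + \<bar>c \<omega> \<bullet> x\<bar>"
    unfolding lprod_inner by (simp flip: abs_mult)
  also have "\<dots> \<le> 2 * (norm (c \<omega>) * norm x) + norm (c \<omega>) * norm x"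
    by (intro add_mono mult_mono component_le_norm_cart Cauchy_Schwarz_ineq2) auto
  also have "\<dots> \<le> 3 * (2 * \<gamma> * norm x)"
    using mult_right_mono[OF norm_c[OF \<omega>], of "norm x"] by (simp add: mult_ac)
  finally show ?thesis by simp
qed

lemma lprod_c_measurable [measurable]: "(\<lambda>\<omega>. lprod (c \<omega>) x) \<in> borel_measurable M"
proof -
  have "(\<lambda>y. lprod y x) \<in> borel_measurable borel"
    by (intro borel_measurable_continuous_onI continuous_intros)
  then show ?thesis by measurable
qed

lemma bounded_weight_lprod: "bounded_weight (\<lambda>\<omega>. of_real (lprod (c \<omega>) x))"
  by (rule bounded_weightI[where B="6 * \<gamma> * norm x"]) (auto simp: lprod_c_bound)

lemma lprod_c_pos:
  assumes "x \<in> forward_cone" "\<omega> \<in> space M"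
  shows "lprod (c \<omega>) x > 0"
proof -
  have "0 < \<gamma> * (x $ None - norm (spatial x))"
    using assms(1) \<gamma>_pos by (simp add: forward_cone_def)
  also have "\<dots> \<le> lprod (c \<omega>) x"
    using lprod_isotropic_bounds(1)[OF c_isotropic[OF assms(2)]] c_None[OF assms(2)] \<gamma>_pos by simp
  finally show ?thesis .
qed

lemma local_bounds:
  assumes "x \<in> forward_cone"
  obtains a b e where "0 < a" "0 < e" "ball x e \<subseteq> forward_cone"
    "\<And>y \<omega>. y \<in> ball x e \<Longrightarrow> \<omega> \<in> space M \<Longrightarrow> lprod (c \<omega>) y \<in> {a..b}"
proof -
  \<comment> \<open>Within distance e of x the first coordinate and the spatial norm each move by
    less than e, so the gap 4e at x is still at least 2e at y.\<close>
  define e where "e = (x $ None - norm (spatial x)) / 4"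
  have e: "e > 0" using assms by (simp add: e_def forward_cone_def)
  have y: "y $ None - norm (spatial y) \<ge> 2 * e" "y $ None + norm (spatial y) \<le> 2 * (norm x + e)"
    if "y \<in> ball x e" for y
  proof -
    have d: "norm (y - x) < e" using that by (simp add: dist_norm norm_minus_commute)
    have "\<bar>(y - x) $ None\<bar> \<le> norm (y - x)" by (rule component_le_norm_cart)
    moreover have "spatial y - spatial x = spatial (y - x)"
      by (simp add: spatial_def algebra_simps)
    then have "norm (spatial y) \<le> norm (spatial x) + norm (y - x)"
      using norm_triangle_ineq2[of "spatial y" "spatial x"] norm_spatial_le[of "y - x"] by simp
    ultimately show "y $ None - norm (spatial y) \<ge> 2 * e" using d by (simp add: e_def field_simps)
    have "norm y \<le> norm x + norm (y - x)" using norm_triangle_ineq2[of y x] by simp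
    then show "y $ None + norm (spatial y) \<le> 2 * (norm x + e)"
      using component_le_norm_cart[of y None] norm_spatial_le[of y] d by simp
  qed
  show ?thesis
  proof (rule that[of "\<gamma> * (2 * e)" e "\<gamma> * (2 * (norm x + e))"])
    show "ball x e \<subseteq> forward_cone"
      using y(1) e by (force simp: forward_cone_def)
    fix y \<omega> assume y': "y \<in> ball x e" and \<omega>: "\<omega> \<in> space M"
    have "\<gamma> * (2 * e) \<le> \<gamma> * (y $ None - norm (spatial y))"
      "\<gamma> * (y $ None + norm (spatial y)) \<le> \<gamma> * (2 * (norm x + e))"
      using y[OF y'] \<gamma>_pos by (auto intro!: mult_left_mono)
    then show "lprod (c \<omega>) y \<in> {\<gamma> * (2 * e)..\<gamma> * (2 * (norm x + e))}"
      using lprod_isotropic_bounds[OF c_isotropic[OF \<omega>], of y] \<gamma>_pos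
      unfolding c_None[OF \<omega>] atLeastAtMost_iff by linarith
  qed (use e \<gamma>_pos in auto)
qed

lemma bounded_weight_powr:
  assumes "x \<in> forward_cone"
  shows "bounded_weight (\<lambda>\<omega>. of_real (lprod (c \<omega>) x) powr \<sigma>)"
proof -
  obtain a b e where "0 < a" "0 < e"
    and "\<And>y \<omega>. y \<in> ball x e \<Longrightarrow> \<omega> \<in> space M \<Longrightarrow> lprod (c \<omega>) y \<in> {a..b}"
    using local_bounds[OF assms] by metis
  then have ab: "\<omega> \<in> space M \<Longrightarrow> lprod (c \<omega>) x \<in> {a..b}" for \<omega> by simp
  obtain B where B: "\<And>t. t \<in> {a..b} \<Longrightarrow> norm ((of_real t :: complex) powr \<sigma>) \<le> B"
    using of_real_powr_bounded[OF \<open>0 < a\<close>] by blast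
  have "(\<lambda>\<omega>. exp (\<sigma> * of_real (ln (lprod (c \<omega>) x)))) \<in> borel_measurable M"
    by measurable
  moreover have "of_real (lprod (c \<omega>) x) powr \<sigma> = exp (\<sigma> * of_real (ln (lprod (c \<omega>) x)))"
    if "\<omega> \<in> space M" for \<omega>
    by (simp add: of_real_powr_exp lprod_c_pos assms that)
  ultimately have "(\<lambda>\<omega>. of_real (lprod (c \<omega>) x) powr \<sigma>) \<in> borel_measurable M"
    by (simp cong: measurable_cong)
  then show ?thesis
    by (rule bounded_weightI[where B=B]) (use ab B in blast)
qed

lemma powr_integral_integrable:
  "x \<in> forward_cone \<Longrightarrow> bounded_weight \<phi> \<Longrightarrow> integrable M (\<lambda>\<omega>. \<phi> \<omega> * of_real (lprod (c \<omega>) x) powr \<sigma>)"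
  by (intro bounded_weight_integrable bounded_weight_mult bounded_weight_powr)

text \<open>Integrating the uniform Taylor remainder gives an error of order |y - x|^2 at once, so
  the exchange of derivative and integral requires no limit theorem.\<close>

lemma powr_integral_has_derivative:
  assumes x: "x \<in> forward_cone" and \<phi>: "bounded_weight \<phi>"
  shows "(powr_integral \<phi> \<sigma> has_derivative (\<lambda>h. \<Sum>i\<in>UNIV. h $ i *\<^sub>R
    powr_integral (\<lambda>\<omega>. \<phi> \<omega> * (\<sigma> * of_real (lprod (c \<omega>) (axis i 1)))) (\<sigma> - 1) x)) (at x)"
proof -
  let ?D = "\<lambda>h. \<Sum>i\<in>UNIV. h $ i *\<^sub>R
    powr_integral (\<lambda>\<omega>. \<phi> \<omega> * (\<sigma> * of_real (lprod (c \<omega>) (axis i 1)))) (\<sigma> - 1) x"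
  let ?d = "\<lambda>h \<omega>. \<phi> \<omega> * (\<sigma> * of_real (lprod (c \<omega>) x) powr (\<sigma> - 1) * of_real (lprod (c \<omega>) h))"
  have int: "integrable M (\<lambda>\<omega>. \<phi> \<omega> * (\<sigma> * of_real (lprod (c \<omega>) h)) * of_real (lprod (c \<omega>) x) powr (\<sigma> - 1))" for h
    by (intro powr_integral_integrable x bounded_weight_mult \<phi> bounded_weight_lprod bounded_weight_const)
  have intd: "integrable M (?d h)" for h
    using int[of h] by (simp add: mult_ac)
  \<comment> \<open>Expanding h in the standard basis merges the coordinatewise integrals into one,
    the linear term with which the Taylor remainder is formed.\<close>
  have D: "?D h = (\<integral>\<omega>. ?d h \<omega> \<partial>M)" for h
  proof -
    have "lprod (c \<omega>) h = (\<Sum>i\<in>UNIV. h $ i * lprod (c \<omega>) (axis i 1))" for \<omega>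
      by (subst (1) basis_expansion[of h, symmetric])
        (simp add: linear_sum[OF bounded_linear.linear[OF bounded_linear_lprod]] scalar_mult_eq_scaleR)
    then have "?d h \<omega> = (\<Sum>i\<in>UNIV. h $ i *\<^sub>R
        (\<phi> \<omega> * (\<sigma> * of_real (lprod (c \<omega>) (axis i 1))) * of_real (lprod (c \<omega>) x) powr (\<sigma> - 1)))" for \<omega>
      by (simp add: sum_distrib_left scaleR_conv_of_real mult_ac)
    then show ?thesis
      unfolding powr_integral_def
      by (simp only: Bochner_Integration.integral_sum integrable_scaleR_right int integral_scaleR_right)
  qed
  obtain a b e where a: "0 < a" and e: "0 < e" "ball x e \<subseteq> forward_cone"
    and ab: "\<And>y \<omega>. y \<in> ball x e \<Longrightarrow> \<omega> \<in> space M \<Longrightarrow> lprod (c \<omega>) y \<in> {a..b}"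
    using local_bounds[OF x] by metis
  obtain C where C: "C \<ge> 0" "\<And>s t. s \<in> {a..b} \<Longrightarrow> t \<in> {a..b} \<Longrightarrow>
    norm ((of_real t :: complex) powr \<sigma> - of_real s powr \<sigma> - \<sigma> * of_real s powr (\<sigma> - 1) * of_real (t - s))
      \<le> C * (t - s)\<^sup>2"
    using of_real_powr_Taylor[OF a] by metis
  obtain B where B: "\<And>\<omega>. \<omega> \<in> space M \<Longrightarrow> norm (\<phi> \<omega>) \<le> B"
    using \<phi> by (auto simp: bounded_weight_def)
  \<comment> \<open>Bound of the weight, Taylor constant, squared bound on the linear form, total
    mass. The absolute value covers an empty space, where B could be negative.\<close>
  define A where "A = \<bar>B\<bar> * (C * (6 * \<gamma>)\<^sup>2) * measure M (space M)"
  have main: "norm (powr_integral \<phi> \<sigma> y - powr_integral \<phi> \<sigma> x - ?D (y - x)) \<le> A * (norm (y - x))\<^sup>2"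
    if y: "y \<in> ball x e" for y
  proof -
    have yf: "y \<in> forward_cone" using y e by blast
    let ?R = "\<lambda>\<omega>. \<phi> \<omega> * of_real (lprod (c \<omega>) y) powr \<sigma> - \<phi> \<omega> * of_real (lprod (c \<omega>) x) powr \<sigma> - ?d (y - x) \<omega>"
    have intR: "integrable M ?R"
      by (intro Bochner_Integration.integrable_diff intd powr_integral_integrable x yf \<phi>)
    have "powr_integral \<phi> \<sigma> y - powr_integral \<phi> \<sigma> x - ?D (y - x) = integral\<^sup>L M ?R"
      unfolding D[of "y - x"] unfolding powr_integral_def
      by (simp add: intd powr_integral_integrable x yf \<phi> Bochner_Integration.integral_diff)
    moreover have "norm (?R \<omega>) \<le> \<bar>B\<bar> * (C * (6 * \<gamma>)\<^sup>2) * (norm (y - x))\<^sup>2" if \<omega>: "\<omega> \<in> space M" for \<omega>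
    proof -
      have yx: "lprod (c \<omega>) (y - x) = lprod (c \<omega>) y - lprod (c \<omega>) x"
        by (rule linear_diff[OF bounded_linear.linear[OF bounded_linear_lprod]])
      have "(lprod (c \<omega>) (y - x))\<^sup>2 \<le> (6 * \<gamma> * norm (y - x))\<^sup>2"
        using lprod_c_bound[OF \<omega>, of "y - x"] \<gamma>_pos by (intro abs_le_square_iff[THEN iffD1]) (simp add: abs_mult)
      then have "C * (lprod (c \<omega>) (y - x))\<^sup>2 \<le> C * (6 * \<gamma> * norm (y - x))\<^sup>2"
        using C(1) by (rule mult_left_mono)
      moreover have "norm (of_real (lprod (c \<omega>) y) powr \<sigma> - of_real (lprod (c \<omega>) x) powr \<sigma>
          - \<sigma> * of_real (lprod (c \<omega>) x) powr (\<sigma> - 1) * of_real (lprod (c \<omega>) (y - x)))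
        \<le> C * (lprod (c \<omega>) (y - x))\<^sup>2"
        unfolding yx using e by (intro C ab \<omega> y) simp
      ultimately have "norm (\<phi> \<omega>) * norm (of_real (lprod (c \<omega>) y) powr \<sigma> - of_real (lprod (c \<omega>) x) powr \<sigma>
          - \<sigma> * of_real (lprod (c \<omega>) x) powr (\<sigma> - 1) * of_real (lprod (c \<omega>) (y - x)))
          \<le> \<bar>B\<bar> * (C * (6 * \<gamma> * norm (y - x))\<^sup>2)"
        using B[OF \<omega>] by (intro mult_mono) auto
      then show ?thesis
        by (simp add: power_mult_distrib right_diff_distrib mult.assoc flip: norm_mult)
    qed
    then have "(\<integral>\<omega>. norm (?R \<omega>) \<partial>M) \<le> (\<integral>\<omega>. \<bar>B\<bar> * (C * (6 * \<gamma>)\<^sup>2) * (norm (y - x))\<^sup>2 \<partial>M)"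
      by (intro integral_mono integrable_norm intR) auto
    then have "norm (integral\<^sup>L M ?R) \<le> (\<integral>\<omega>. \<bar>B\<bar> * (C * (6 * \<gamma>)\<^sup>2) * (norm (y - x))\<^sup>2 \<partial>M)"
      by (rule order_trans[OF integral_norm_bound])
    ultimately show ?thesis by (simp add: A_def mult_ac)
  qed
  show ?thesis
  proof (rule has_derivativeI_sandwich[OF e(1)])
    show "bounded_linear ?D"
      by (intro bounded_linear_sum bounded_linear_scaleR_const bounded_linear_vec_nth)
    show "((\<lambda>y. A * norm (y - x)) \<longlongrightarrow> 0) (at x)"
      by (auto intro!: tendsto_eq_intros)
    fix y assume y: "y \<noteq> x" "dist y x < e"
    then show "norm (powr_integral \<phi> \<sigma> y - powr_integral \<phi> \<sigma> x - ?D (y - x)) / norm (y - x) \<le> A * norm (y - x)"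
      using main[of y] by (simp add: divide_le_eq power2_eq_square dist_commute mult.assoc)
  qed
qed

end

section \<open>From the forward cone to the whole positive cone\<close>

definition forward_extend :: "(real ^ 'q::finite option \<Rightarrow> complex) \<Rightarrow> real ^ 'q option \<Rightarrow> complex"
  where "forward_extend g x = (if x $ None > 0 then g x else 0)"

text \<open>The hyperplane of vanishing first coordinate misses the positive cone, so the two halves
  are separated by open sets and differentiation commutes with extension by zero.\<close>

lemma forward_extend_has_derivative:
  assumes g: "\<And>x. x \<in> forward_cone \<Longrightarrow> (g has_derivative (\<lambda>h. \<Sum>i\<in>UNIV. h $ i *\<^sub>R p i x)) (at x)"
    and x: "x \<in> positive_cone"
  shows "(forward_extend g has_derivative (\<lambda>h. \<Sum>i\<in>UNIV. h $ i *\<^sub>R forward_extend (p i) x)) (at x)"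
proof (cases "x $ None > 0")
  case True
  then have xf: "x \<in> forward_cone" using x by (simp add: forward_cone_iff)
  have "(forward_extend g has_derivative (\<lambda>h. \<Sum>i\<in>UNIV. h $ i *\<^sub>R p i x)) (at x)"
    using g[OF xf] open_forward_cone xf
    by (rule has_derivative_transform_within_open) (simp add: forward_extend_def forward_cone_iff)
  then show ?thesis using True by (simp add: forward_extend_def)
next
  case False
  then have xn: "x $ None < 0" using None_nonzero_positive_cone[OF x] by simp
  have "open {y :: real ^ 'a option. y $ None < 0}"
    by (intro open_Collect_less continuous_intros)
  then have "(forward_extend g has_derivative (\<lambda>h. 0)) (at x)"
    by (rule has_derivative_transform_within_open[OF has_derivative_const])
      (use xn in \<open>auto simp: forward_extend_def\<close>)
  then show ?thesis using False by (simp add: forward_extend_def)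
qed

lemma lprod_axis [simp]: "lprod c (axis None 1) = c $ None" "lprod c (axis (Some i) 1) = - c $ Some i"
  by (simp_all add: lprod_inner inner_axis) (simp add: axis_def)

context isotropic_family
begin

lemma powr_integral_in_harmonic_space:
  "forward_extend (powr_integral (\<lambda>_. a) \<rho>) \<in> harmonic_space \<rho>"
proof -
  let ?F = "forward_extend (powr_integral (\<lambda>_. a) \<rho>)"
  \<comment> \<open>\<open>cc i\<close> is the factor that one derivative along axis i brings down;
    \<open>\<phi>1\<close> and \<open>\<phi>2\<close> are the weights after one and two
    derivatives.\<close>
  define cc :: "'q option \<Rightarrow> 'w \<Rightarrow> complex" where "cc i \<omega> = of_real (lprod (c \<omega>) (axis i 1))" for i \<omega>
  define \<phi>1 where "\<phi>1 i \<omega> = a * (\<rho> * cc i \<omega>)" for i \<omega>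
  define \<phi>2 where "\<phi>2 i j \<omega> = \<phi>1 i \<omega> * ((\<rho> - 1) * cc j \<omega>)" for i j \<omega>
  have wc: "bounded_weight (cc i)" for i
    unfolding cc_def [abs_def] by (rule bounded_weight_lprod)
  have w1: "bounded_weight (\<phi>1 i)" for i
    unfolding \<phi>1_def [abs_def] by (intro bounded_weight_mult bounded_weight_const wc)
  have w2: "bounded_weight (\<phi>2 i j)" for i j
    unfolding \<phi>2_def [abs_def] by (intro bounded_weight_mult bounded_weight_const w1 wc)
  let ?p = "\<lambda>i. forward_extend (powr_integral (\<phi>1 i) (\<rho> - 1))"
  let ?r = "\<lambda>i j. forward_extend (powr_integral (\<phi>2 i j) (\<rho> - 1 - 1))"
  have dF: "(?F has_derivative (\<lambda>h. \<Sum>i\<in>UNIV. h $ i *\<^sub>R ?p i x)) (at x)" if "x \<in> positive_cone" for x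
    using forward_extend_has_derivative[OF powr_integral_has_derivative[OF _ bounded_weight_const[of a]] that, of \<rho>]
    unfolding \<phi>1_def [abs_def] cc_def by simp
  have dp: "(?p i has_derivative (\<lambda>h. \<Sum>j\<in>UNIV. h $ j *\<^sub>R ?r i j x)) (at x)" if "x \<in> positive_cone" for x i
    using forward_extend_has_derivative[OF powr_integral_has_derivative[OF _ w1[of i]] that, of "\<rho> - 1"]
    unfolding \<phi>2_def [abs_def] cc_def by simp
  \<comment> \<open>The second partial derivatives are again integrals with bounded weight, so they
    can be differentiated once more and are therefore continuous.\<close>
  have cr: "continuous_on positive_cone (?r i j)" for i j
  proof (rule continuous_at_imp_continuous_on, rule ballI)
    fix x :: "real ^ 'q option" assume x: "x \<in> positive_cone"
    show "isCont (?r i j) x"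
      by (rule has_derivative_continuous,
          rule forward_extend_has_derivative[OF powr_integral_has_derivative[OF _ w2] x])
  qed
  have "C2_on positive_cone ?F"
    by (rule C2_on_partials[OF dF dp cr])
  moreover have "?F (l *\<^sub>R x) = of_real l powr \<rho> * ?F x" if x: "x \<in> positive_cone" and l: "l > 0" for x l
  proof (cases "x $ None > 0")
    case True
    then have xf: "x \<in> forward_cone" using x by (simp add: forward_cone_iff)
    have "powr_integral (\<lambda>_. a) \<rho> (l *\<^sub>R x)
        = (\<integral>\<omega>. of_real l powr \<rho> * (a * of_real (lprod (c \<omega>) x) powr \<rho>) \<partial>M)"
      unfolding powr_integral_def
      by (intro Bochner_Integration.integral_cong refl)
        (use l lprod_c_pos[OF xf] in \<open>simp add: powr_times_real less_imp_le\<close>)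
    then show ?thesis using True l by (simp add: forward_extend_def zero_less_mult_iff powr_integral_def)
  next
    case False
    then show ?thesis using l by (simp add: forward_extend_def zero_less_mult_iff)
  qed
  moreover have "wave_op ?F x = 0" if x: "x \<in> positive_cone" for x
  proof -
    have "?r None None x - (\<Sum>i\<in>UNIV. ?r (Some i) (Some i) x) = 0"
    proof (cases "x $ None > 0")
      case True
      then have xf: "x \<in> forward_cone" using x by (simp add: forward_cone_iff)
      let ?P = "\<lambda>\<omega>. of_real (lprod (c \<omega>) x) powr (\<rho> - 1 - 1)"
      have "?r None None x - (\<Sum>i\<in>UNIV. ?r (Some i) (Some i) x)
          = (\<integral>\<omega>. \<phi>2 None None \<omega> * ?P \<omega> - (\<Sum>i\<in>UNIV. \<phi>2 (Some i) (Some i) \<omega> * ?P \<omega>) \<partial>M)"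
        using True
        by (simp add: forward_extend_def powr_integral_def powr_integral_integrable[OF xf w2]
          Bochner_Integration.integral_diff Bochner_Integration.integral_sum Bochner_Integration.integrable_sum)
      also have "\<dots> = (\<integral>\<omega>. 0 \<partial>M)"
      proof (intro Bochner_Integration.integral_cong refl)
        fix \<omega> assume \<omega>: "\<omega> \<in> space M"
        \<comment> \<open>The product with a spatial axis vector is the coordinate with a minus
          sign; it occurs twice, so the sign cancels, and the signs of the wave operator rebuild the
          Lorentzian square of c(\<omega>).\<close>
        have "\<phi>2 None None \<omega> * ?P \<omega> - (\<Sum>i\<in>UNIV. \<phi>2 (Some i) (Some i) \<omega> * ?P \<omega>)
            = a * \<rho> * (\<rho> - 1) * ?P \<omega> * of_real (lprod (c \<omega>) (c \<omega>))"
        proof -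
          have "\<phi>2 None None \<omega> * ?P \<omega> = a * \<rho> * (\<rho> - 1) * ?P \<omega> * of_real (c \<omega> $ None * c \<omega> $ None)"
            "\<phi>2 (Some i) (Some i) \<omega> * ?P \<omega>
              = a * \<rho> * (\<rho> - 1) * ?P \<omega> * of_real (c \<omega> $ Some i * c \<omega> $ Some i)" for i
            by (simp_all add: \<phi>2_def \<phi>1_def cc_def)
          then show ?thesis
            unfolding lprod_def[of "c \<omega>" "c \<omega>"] of_real_diff of_real_sum
            by (simp only: right_diff_distrib sum_distrib_left)
        qed
        then show "\<phi>2 None None \<omega> * ?P \<omega> - (\<Sum>i\<in>UNIV. \<phi>2 (Some i) (Some i) \<omega> * ?P \<omega>) = 0"
          using c_isotropic[OF \<omega>] by (simp add: isotropic_def)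
      qed
      finally show ?thesis by simp
    qed (simp add: forward_extend_def)
    then show ?thesis using wave_op_eq[OF open_positive_cone x dF dp] by simp
  qed
  ultimately show ?thesis by (simp add: harmonic_space_def)
qed

lemma spherical_harmonic_powr_integral: "spherical_harmonic \<rho> (powr_integral (\<lambda>_. a) \<rho>)"
  unfolding spherical_harmonic_def using powr_integral_in_harmonic_space[where a = a]
  by (rule rev_bexI) (simp add: forward_extend_def hyp_sphere_eq)

text \<open>The product of c(\<omega>) with e is \<gamma> for every \<omega>, so the integrand is
  constant. With a and the total mass non-zero, this value is non-zero for every \<rho>.\<close>

lemma powr_integral_base_point:
  "powr_integral (\<lambda>_. a) \<rho> base_point = of_real (measure M (space M)) * (a * of_real \<gamma> powr \<rho>)"
proof -
  have "powr_integral (\<lambda>_. a) \<rho> base_point = (\<integral>\<omega>. a * of_real \<gamma> powr \<rho> \<partial>M)"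
    unfolding powr_integral_def by (intro Bochner_Integration.integral_cong refl) (simp add: c_None)
  then show ?thesis by (simp add: scaleR_conv_of_real)
qed

text \<open>Substitute T k \<omega> for \<omega>: the measure does not change, and k drops out of
  the product of k c(\<omega>) with k x.\<close>

lemma K_invariant_powr_integral:
  assumes T: "\<And>k. k \<in> stabilizer_K \<Longrightarrow> T k \<in> M \<rightarrow>\<^sub>M M \<and> distr M M (T k) = M"
    and cT: "\<And>k \<omega>. k \<in> stabilizer_K \<Longrightarrow> \<omega> \<in> space M \<Longrightarrow> c (T k \<omega>) = k *v c \<omega>"
  shows "K_invariant (powr_integral (\<lambda>_. a) \<rho>)"
  unfolding K_invariant_def
proof (intro ballI)
  fix k :: "real ^ 'q option ^ 'q option" and x :: "real ^ 'q option"
  assume k: "k \<in> stabilizer_K" and x: "x \<in> hyp_sphere"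
  have "k *v x \<in> forward_cone"
    using stabilizer_hyp_sphere[OF k x] hyp_sphere_subset_forward_cone by blast
  then have m: "(\<lambda>\<omega>. a * of_real (lprod (c \<omega>) (k *v x)) powr \<rho>) \<in> borel_measurable M"
    using bounded_weight_mult[OF bounded_weight_const bounded_weight_powr] by (auto simp: bounded_weight_def)
  have "powr_integral (\<lambda>_. a) \<rho> (k *v x)
      = (\<integral>\<omega>. a * of_real (lprod (c \<omega>) (k *v x)) powr \<rho> \<partial>distr M M (T k))"
    using T[OF k] by (simp add: powr_integral_def)
  also have "\<dots> = (\<integral>\<omega>. a * of_real (lprod (c (T k \<omega>)) (k *v x)) powr \<rho> \<partial>M)"
    using T[OF k] m by (intro integral_distr) auto
  also have "\<dots> = powr_integral (\<lambda>_. a) \<rho> x"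
    unfolding powr_integral_def
    by (intro Bochner_Integration.integral_cong refl) (simp add: cT k stabilizer_lprod)
  finally show "powr_integral (\<lambda>_. a) \<rho> (k *v x) = powr_integral (\<lambda>_. a) \<rho> x" .
qed

end

section \<open>The radial equation\<close>

text \<open>The restriction of a \<open>K\<close>-invariant harmonic function to the ray
  \<open>s \<mapsto> e + s e\<^sub>j\<close> solves this equation (with \<open>m = q - 1\<close>), which is singular at \<open>s = 0\<close>.\<close>

definition radial_solution ::
    "real \<Rightarrow> complex \<Rightarrow> (real \<Rightarrow> complex) \<Rightarrow> (real \<Rightarrow> complex) \<Rightarrow> (real \<Rightarrow> complex) \<Rightarrow> bool"
  where "radial_solution m \<rho> g g' g'' \<longleftrightarrow>
    (\<forall>s. \<bar>s\<bar> < 1 \<longrightarrow> (g has_vector_derivative g' s) (at s)) \<and>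
    (\<forall>s. \<bar>s\<bar> < 1 \<longrightarrow> (g' has_vector_derivative g'' s) (at s)) \<and> g' 0 = 0 \<and>
    (\<forall>s. 0 < s \<and> s < 1 \<longrightarrow> of_real (1 - s\<^sup>2) * g'' s
      = \<rho> * (\<rho> - 1) * g s - of_real (2 * s) * (\<rho> - 1) * g' s - of_real (m / s) * g' s)"

lemma radial_solution_diff:
  assumes "radial_solution m \<rho> g g' g''" "radial_solution m \<rho> h h' h''"
  shows "radial_solution m \<rho> (\<lambda>s. g s - a * h s) (\<lambda>s. g' s - a * h' s) (\<lambda>s. g'' s - a * h'' s)"
proof -
  have "of_real (1 - s\<^sup>2) * (g'' s - a * h'' s) = \<rho> * (\<rho> - 1) * (g s - a * h s)
      - of_real (2 * s) * (\<rho> - 1) * (g' s - a * h' s) - of_real (m / s) * (g' s - a * h' s)"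
    if "0 < s" "s < 1" for s
  proof -
    have "of_real (1 - s\<^sup>2) * (g'' s - a * h'' s) = of_real (1 - s\<^sup>2) * g'' s - a * (of_real (1 - s\<^sup>2) * h'' s)"
      by (simp only: algebra_simps)
    also have "\<dots> = (\<rho> * (\<rho> - 1) * g s - of_real (2 * s) * (\<rho> - 1) * g' s - of_real (m / s) * g' s)
      - a * (\<rho> * (\<rho> - 1) * h s - of_real (2 * s) * (\<rho> - 1) * h' s - of_real (m / s) * h' s)"
      using assms that unfolding radial_solution_def by metis
    finally show ?thesis by (simp only: algebra_simps)
  qed
  then show ?thesis
    using assms unfolding radial_solution_def
    by (auto intro!: has_vector_derivative_diff has_vector_derivative_mult_right)
qed

text \<open>The energy \<open>|g|\<^sup>2 + |g'|\<^sup>2\<close> satisfies a linear differential inequality on \<open>[0, b]\<close>: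
  the singular term \<open>- (m / s) g'\<close> only decreases it.\<close>

lemma radial_solution_zero:
  assumes g: "radial_solution m \<rho> g g' g''" and m: "m \<ge> 0" and g0: "g 0 = 0" and b: "0 \<le> b" "b < 1"
  shows "g b = 0"
proof -
  \<comment> \<open>Pairing the equation with g' gives (1 - s^2) g' \<bullet> g'' \<le> A E / 2 + 2
    B E. Doubling this and dividing by 1 - b^2 yields the second summand of L; the 1 comes from 2 g
    \<bullet> g' \<le> E. The estimate stops at b < 1 because 1 - s^2 vanishes on the light cone s =
    1.\<close>
  define A B L where "A = norm (\<rho> * (\<rho> - 1))" and "B = norm (\<rho> - 1)" and "L = 1 + (A + 4 * B) / (1 - b\<^sup>2)"
  define E where "E s = g s \<bullet> g s + g' s \<bullet> g' s" for s
  have b2: "1 - b\<^sup>2 > 0" using b by (simp add: power_less_one_iff abs_square_less_1)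
  have dE: "(E has_real_derivative 2 * (g s \<bullet> g' s) + 2 * (g' s \<bullet> g'' s)) (at s)" if "\<bar>s\<bar> < 1" for s
  proof -
    have "(g has_vector_derivative g' s) (at s)" "(g' has_vector_derivative g'' s) (at s)"
      using g that by (auto simp: radial_solution_def)
    then show ?thesis
      unfolding E_def has_real_derivative_iff_has_vector_derivative
      by (auto intro!: derivative_eq_intros bounded_bilinear.has_vector_derivative[OF bounded_bilinear_inner]
          simp: inner_commute)
  qed
  have ineq: "2 * (g s \<bullet> g' s) + 2 * (g' s \<bullet> g'' s) \<le> L * E s" if s: "0 < s" "s < b" for s
  proof -
    have s2: "1 - s\<^sup>2 > 0" "1 - b\<^sup>2 \<le> 1 - s\<^sup>2" using s b by (auto simp: abs_square_less_1 intro!: power_mono)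
    have ode: "(1 - s\<^sup>2) *\<^sub>R g'' s = \<rho> * (\<rho> - 1) * g s - (2 * s) *\<^sub>R ((\<rho> - 1) * g' s) - (m / s) *\<^sub>R g' s"
      using g s b unfolding radial_solution_def by (simp add: scaleR_conv_of_real mult.assoc)
    have E: "norm (g s) * norm (g' s) \<le> E s / 2" "(norm (g' s))\<^sup>2 \<le> E s" "E s \<ge> 0" "g s \<bullet> g' s \<le> E s / 2"
    proof -
      have "0 \<le> (norm (g s) - norm (g' s))\<^sup>2" by simp
      then show 1: "norm (g s) * norm (g' s) \<le> E s / 2"
        by (simp add: E_def power2_diff flip: power2_norm_eq_inner)
      show "g s \<bullet> g' s \<le> E s / 2" using 1 norm_cauchy_schwarz[of "g s" "g' s"] by simp
      show "(norm (g' s))\<^sup>2 \<le> E s" "E s \<ge> 0" by (simp_all add: E_def power2_norm_eq_inner)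
    qed
    have AB: "A \<ge> 0" "B \<ge> 0" by (simp_all add: A_def B_def)
    have "(1 - s\<^sup>2) * (g' s \<bullet> g'' s) = g' s \<bullet> (\<rho> * (\<rho> - 1) * g s) - 2 * s * (g' s \<bullet> ((\<rho> - 1) * g' s))
        - (m / s) * (g' s \<bullet> g' s)"
      using arg_cong[OF ode, of "\<lambda>z. g' s \<bullet> z"] by (simp add: inner_diff_right)
    moreover have "g' s \<bullet> (\<rho> * (\<rho> - 1) * g s) \<le> A * (E s / 2)"
    proof -
      have "g' s \<bullet> (\<rho> * (\<rho> - 1) * g s) \<le> norm (g' s) * norm (\<rho> * (\<rho> - 1) * g s)"
        by (rule norm_cauchy_schwarz)
      also have "\<dots> = A * (norm (g s) * norm (g' s))" by (simp add: A_def norm_mult)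
      also have "\<dots> \<le> A * (E s / 2)" using E(1) AB(1) by (rule mult_left_mono)
      finally show ?thesis .
    qed
    moreover have "- (2 * s * (g' s \<bullet> ((\<rho> - 1) * g' s))) \<le> 2 * (B * E s)"
    proof -
      have "\<bar>g' s \<bullet> ((\<rho> - 1) * g' s)\<bar> \<le> norm (g' s) * norm ((\<rho> - 1) * g' s)"
        by (rule Cauchy_Schwarz_ineq2)
      also have "\<dots> = B * (norm (g' s))\<^sup>2" by (simp add: B_def norm_mult power2_eq_square)
      also have "\<dots> \<le> B * E s" using E(2) AB(2) by (rule mult_left_mono)
      finally have "s * \<bar>g' s \<bullet> ((\<rho> - 1) * g' s)\<bar> \<le> 1 * (B * E s)"
        using s b by (intro mult_mono) auto
      then show ?thesis using s by (simp add: abs_if split: if_splits) (smt (verit) mult_nonneg_nonneg)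
    qed
    moreover have "m / s * (g' s \<bullet> g' s) \<ge> 0" using m s by simp
    ultimately have "(1 - s\<^sup>2) * (g' s \<bullet> g'' s) \<le> A * (E s / 2) + 2 * (B * E s)" by linarith
    then have "g' s \<bullet> g'' s \<le> (A * (E s / 2) + 2 * (B * E s)) / (1 - s\<^sup>2)"
      using s2 by (simp add: pos_le_divide_eq mult.commute)
    also have "\<dots> \<le> (A * (E s / 2) + 2 * (B * E s)) / (1 - b\<^sup>2)"
      using s2 b2 AB E(3) by (intro divide_left_mono) auto
    also have "\<dots> = (A + 4 * B) / (1 - b\<^sup>2) * (E s / 2)"
      by (simp add: field_simps)
    finally have "g' s \<bullet> g'' s \<le> (A + 4 * B) / (1 - b\<^sup>2) * (E s / 2)" .
    moreover have "L * E s = E s + 2 * ((A + 4 * B) / (1 - b\<^sup>2) * (E s / 2))"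
    proof -
      have "(1 + K) * e = e + 2 * (K * (e / 2))" for K e :: real by (simp add: distrib_right)
      then show ?thesis unfolding L_def .
    qed
    ultimately show ?thesis using E(4) by linarith
  qed
  have dh: "((\<lambda>s. E s * exp (- L * s)) has_real_derivative
      (2 * (g s \<bullet> g' s) + 2 * (g' s \<bullet> g'' s) - L * E s) * exp (- L * s)) (at s)" if "\<bar>s\<bar> < 1" for s
    using dE[OF that] by (auto intro!: derivative_eq_intros simp: algebra_simps)
  \<comment> \<open>Gronwall's argument. The differential inequality is available only for s > 0,
    where the equation holds; at the endpoint 0 continuity is enough.\<close>
  have "E b * exp (- L * b) \<le> E 0 * exp (- L * 0)"
  proof (rule DERIV_nonpos_imp_decreasing_open[OF b(1), of "\<lambda>s. E s * exp (- L * s)"])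
    fix s assume "0 < s" "s < b"
    then show "\<exists>y. ((\<lambda>s. E s * exp (- L * s)) has_real_derivative y) (at s) \<and> y \<le> 0"
      using dh[of s] ineq[of s] b by (intro exI conjI) (auto simp: mult_nonpos_nonneg)
  next
    show "continuous_on {0..b} (\<lambda>s. E s * exp (- L * s))"
      using b by (intro continuous_at_imp_continuous_on ballI DERIV_isCont[OF dh]) auto
  qed
  moreover have "E 0 = 0" using g g0 by (simp add: E_def radial_solution_def)
  ultimately have "E b \<le> 0" by (simp add: mult_le_0_iff)
  then have "g b \<bullet> g b \<le> 0" using inner_ge_zero[of "g' b"] unfolding E_def by linarith
  then show ?thesis by (metis inner_gt_zero_iff not_less)
qed

section \<open>Second derivatives along the coordinate axes\<close>

lemma has_vector_derivative_chain_real: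
  assumes "(h has_real_derivative h') (at t)" "(g has_vector_derivative g') (at (h t))"
  shows "((\<lambda>t. g (h t)) has_vector_derivative h' *\<^sub>R g') (at t)"
  using vector_diff_chain_at[of h h' t g g'] assms
  by (simp add: o_def has_real_derivative_iff_has_vector_derivative)

text \<open>Iterating \<open>partial_deriv\<close> in one direction sees f only on the line through
  x in that direction. A one-variable formula for f on a segment of that line therefore
  suffices.\<close>

lemma second_partial_deriv:
  fixes f :: "real ^ 'q::finite option \<Rightarrow> complex"
  assumes "\<delta> > 0" and f: "\<And>t. \<bar>t\<bar> < \<delta> \<Longrightarrow> f (x + t *\<^sub>R axis i 1) = \<phi> t"
    and \<phi>: "\<And>t. \<bar>t\<bar> < \<delta> \<Longrightarrow> (\<phi> has_vector_derivative \<phi>' t) (at t)"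
    and \<phi>': "(\<phi>' has_vector_derivative \<phi>'') (at 0)"
  shows "partial_deriv i (partial_deriv i f) x = \<phi>''"
proof -
  have 1: "partial_deriv i f (x + t *\<^sub>R axis i 1) = \<phi>' t" if t: "\<bar>t\<bar> < \<delta>" for t
  proof -
    have "((\<lambda>r. \<phi> (t + r)) has_vector_derivative 1 *\<^sub>R \<phi>' t) (at 0)"
      using \<phi>[OF t] by (intro has_vector_derivative_chain_real) (auto intro!: derivative_eq_intros)
    then have "((\<lambda>r. f (x + t *\<^sub>R axis i 1 + r *\<^sub>R axis i 1)) has_vector_derivative 1 *\<^sub>R \<phi>' t) (at 0)"
    proof (rule has_vector_derivative_transform_within_open)
      show "open {- \<delta> - t<..<\<delta> - t}" "0 \<in> {- \<delta> - t<..<\<delta> - t}" using t by auto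
      fix r assume "r \<in> {- \<delta> - t<..<\<delta> - t}"
      then have "\<bar>t + r\<bar> < \<delta>" by auto
      from f[OF this] show "\<phi> (t + r) = f (x + t *\<^sub>R axis i 1 + r *\<^sub>R axis i 1)"
        by (simp add: scaleR_left_distrib add.assoc)
    qed
    then show ?thesis by (simp add: partial_deriv_def vector_derivative_at)
  qed
  have "((\<lambda>t. partial_deriv i f (x + t *\<^sub>R axis i 1)) has_vector_derivative \<phi>'') (at 0)"
    by (rule has_vector_derivative_transform_within_open[OF \<phi>', of "{- \<delta><..<\<delta>}"])
      (use 1 \<open>\<delta> > 0\<close> in auto)
  then show ?thesis by (subst partial_deriv_def) (simp add: vector_derivative_at)
qed

text \<open>By homogeneity, (1 + t)^\<rho> g(s / (1 + t)) is the value of the harmonic function at e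
  + s e_j + t e. The range of t keeps s / (1 + t) below 1, inside the forward cone.\<close>

lemma homogeneous_None_derivative:
  fixes \<rho> :: complex
  assumes s: "0 < s" "s < 1"
    and g: "\<And>s. \<bar>s\<bar> < 1 \<Longrightarrow> (g has_vector_derivative g' s) (at s)"
    and g': "\<And>s. \<bar>s\<bar> < 1 \<Longrightarrow> (g' has_vector_derivative g'' s) (at s)"
  defines "\<phi> \<equiv> \<lambda>t. of_real (1 + t) powr \<rho> * g (s / (1 + t))"
    and "\<phi>' \<equiv> \<lambda>t. of_real (1 + t) powr \<rho> * ((- s / (1 + t)\<^sup>2) *\<^sub>R g' (s / (1 + t)))
      + \<rho> * of_real (1 + t) powr (\<rho> - 1) * g (s / (1 + t))"
  shows "\<bar>t\<bar> < 1 - s \<Longrightarrow> (\<phi> has_vector_derivative \<phi>' t) (at t)"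
    and "(\<phi>' has_vector_derivative \<rho> * (\<rho> - 1) * g s - of_real (2 * s) * (\<rho> - 1) * g' s
      + of_real (s\<^sup>2) * g'' s) (at 0)"
proof -
  have pw: "((\<lambda>t. of_real (1 + t) powr \<sigma>) has_vector_derivative 1 *\<^sub>R (\<sigma> * of_real (1 + t) powr (\<sigma> - 1))) (at t)"
    if "\<bar>t\<bar> < 1 - s" for t and \<sigma> :: complex
  proof (rule has_vector_derivative_chain_real)
    show "((\<lambda>t. 1 + t) has_real_derivative 1) (at t)" by (auto intro!: derivative_eq_intros)
    show "((\<lambda>t. of_real t powr \<sigma>) has_vector_derivative \<sigma> * of_real (1 + t) powr (\<sigma> - 1)) (at (1 + t))"
      using that s by (intro of_real_powr_has_vector_derivative) auto
  qed
  have q: "((\<lambda>t. s / (1 + t)) has_real_derivative - s / (1 + t)\<^sup>2) (at t)" if "\<bar>t\<bar> < 1 - s" for t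
    using that s by (auto intro!: derivative_eq_intros simp: power2_eq_square)
  have q1: "\<bar>s / (1 + t)\<bar> < 1" if "\<bar>t\<bar> < 1 - s" for t
  proof -
    have "1 + t > s" using that by linarith
    then show ?thesis using s by (simp add: abs_divide)
  qed
  have gq: "((\<lambda>t. g (s / (1 + t))) has_vector_derivative (- s / (1 + t)\<^sup>2) *\<^sub>R g' (s / (1 + t))) (at t)"
    "((\<lambda>t. g' (s / (1 + t))) has_vector_derivative (- s / (1 + t)\<^sup>2) *\<^sub>R g'' (s / (1 + t))) (at t)"
    if "\<bar>t\<bar> < 1 - s" for t
    using that by (intro has_vector_derivative_chain_real q g g' q1; simp)+
  show "(\<phi> has_vector_derivative \<phi>' t) (at t)" if "\<bar>t\<bar> < 1 - s"
    unfolding \<phi>_def \<phi>'_def using has_vector_derivative_mult[OF pw[OF that, of \<rho>] gq(1)[OF that]]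
    by simp
  have t0: "\<bar>0\<bar> < 1 - s" using s by simp
  have q2: "((\<lambda>t. - s / (1 + t)\<^sup>2) has_real_derivative 2 * s) (at 0)"
    by (auto intro!: derivative_eq_intros simp: power2_eq_square)
  have "((\<lambda>t. (- s / (1 + t)\<^sup>2) *\<^sub>R g' (s / (1 + t))) has_vector_derivative
      (- s) *\<^sub>R ((- s) *\<^sub>R g'' s) + (2 * s) *\<^sub>R g' s) (at 0)"
    using has_vector_derivative_scaleR[OF q2 gq(2)[OF t0]] by simp
  from has_vector_derivative_add[OF has_vector_derivative_mult[OF pw[OF t0, of \<rho>] this]
      has_vector_derivative_mult[OF has_vector_derivative_mult_right[OF pw[OF t0, of "\<rho> - 1"], of \<rho>] gq(1)[OF t0]]]
  show "(\<phi>' has_vector_derivative \<rho> * (\<rho> - 1) * g s - of_real (2 * s) * (\<rho> - 1) * g' s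
      + of_real (s\<^sup>2) * g'' s) (at 0)"
    unfolding \<phi>'_def
    by (rule has_vector_derivative_eq_rhs) (simp add: scaleR_conv_of_real algebra_simps power2_eq_square)
qed

text \<open>Leaving the ray by b in a spatial direction orthogonal to it changes the spatial norm
  from s to sqrt(s^2 + b^2). The second derivative at b = 0 is g'(s) / s, the source of the singular
  term.\<close>

lemma radial_transversal_derivative:
  assumes s: "0 < s" "s < 1"
    and g: "\<And>s. \<bar>s\<bar> < 1 \<Longrightarrow> (g has_vector_derivative g' s) (at s)"
    and g': "\<And>s. \<bar>s\<bar> < 1 \<Longrightarrow> (g' has_vector_derivative g'' s) (at s)"
  defines "r \<equiv> \<lambda>b. sqrt (s\<^sup>2 + b\<^sup>2)"
  shows "\<bar>b\<bar> < 1 - s \<Longrightarrow> ((\<lambda>b. g (r b)) has_vector_derivative (b / r b) *\<^sub>R g' (r b)) (at b)"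
    and "((\<lambda>b. (b / r b) *\<^sub>R g' (r b)) has_vector_derivative of_real (1 / s) * g' s) (at 0)"
proof -
  have pos: "s\<^sup>2 + b\<^sup>2 > 0" for b using s by (simp add: add_pos_nonneg)
  have dr: "(r has_real_derivative b / r b) (at b)" for b
    unfolding r_def using pos[of b]
    by (auto intro!: derivative_eq_intros simp: field_simps)
  have r1: "\<bar>r b\<bar> < 1" if "\<bar>b\<bar> < 1 - s" for b
  proof -
    have "\<bar>r b\<bar> = r b" by (simp add: r_def)
    also have "\<dots> \<le> \<bar>s\<bar> + \<bar>b\<bar>" unfolding r_def by (rule sqrt_sum_squares_le_sum_abs)
    finally show ?thesis using that s by linarith
  qed
  have 1: "((\<lambda>b. g (r b)) has_vector_derivative (b / r b) *\<^sub>R g' (r b)) (at b)"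
    "((\<lambda>b. g' (r b)) has_vector_derivative (b / r b) *\<^sub>R g'' (r b)) (at b)"
    if "\<bar>b\<bar> < 1 - s" for b
    using that by (intro has_vector_derivative_chain_real dr g g' r1; simp)+
  then show "((\<lambda>b. g (r b)) has_vector_derivative (b / r b) *\<^sub>R g' (r b)) (at b)" if "\<bar>b\<bar> < 1 - s"
    using that by blast
  have r0: "r 0 = s" using s by (simp add: r_def)
  have "((\<lambda>b. b / r b) has_real_derivative 1 / s) (at 0)"
    using DERIV_divide[OF DERIV_ident dr[of 0]] s by (simp add: r0)
  from has_vector_derivative_scaleR[OF this 1(2)[of 0]] s
  show "((\<lambda>b. (b / r b) *\<^sub>R g' (r b)) has_vector_derivative of_real (1 / s) * g' s) (at 0)"
    by (simp add: r0 scaleR_conv_of_real)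
qed

text \<open>A rotation in \<open>K\<close> moves the spatial part onto the ray and homogeneity
  scales the first coordinate to 1, which gives the formula for v. The wave equation at points of
  the ray then becomes the radial equation.\<close>

lemma K_spherical_function_radial:
  fixes v :: "real ^ 'q::finite option \<Rightarrow> complex"
  assumes n: "CARD('q option) \<ge> 3" and v: "K_spherical_function \<rho> v"
  obtains g g' g'' where "radial_solution (real CARD('q) - 1) \<rho> g g' g''"
    "\<And>x. x \<in> hyp_sphere \<Longrightarrow> v x = of_real (x $ None) powr \<rho> * g (norm (spatial x) / x $ None)"
proof -
  obtain f where f: "f \<in> harmonic_space \<rho>" and vf: "\<And>x. x \<in> hyp_sphere \<Longrightarrow> v x = f x"
    using v by (auto simp: K_spherical_function_def spherical_harmonic_def)
  have hom: "f (l *\<^sub>R x) = of_real l powr \<rho> * f x" if "x \<in> positive_cone" "l > 0" for x l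
    using f that by (simp add: harmonic_space_def)
  have wave: "wave_op f x = 0" if "x \<in> positive_cone" for x
    using f that by (simp add: harmonic_space_def)
  \<comment> \<open>Invariance is given on \<open>hyp_sphere\<close> only; homogeneity carries it
    along rays to the whole forward cone.\<close>
  have inv: "f (k *v x) = f x" if k: "k \<in> stabilizer_K" and x: "x \<in> forward_cone" for k x
  proof -
    define y where "y = (1 / lnorm x) *\<^sub>R x"
    note y = forward_cone_normalize[OF x, folded y_def]
    have yp: "y \<in> positive_cone" "k *v y \<in> positive_cone"
      using y(1) stabilizer_hyp_sphere[OF k y(1)] hyp_sphere_subset_forward_cone by (auto simp: forward_cone_iff)
    have "v (k *v y) = v y"
      using v y(1) k by (simp add: K_spherical_function_def K_invariant_def)
    then have "f (k *v y) = f y"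
      using vf[OF y(1)] vf[OF stabilizer_hyp_sphere[OF k y(1)]] by simp
    moreover have "lnorm x *\<^sub>R y = x" "lnorm x *\<^sub>R (k *v y) = k *v x"
      using y(2) by (simp_all add: y_def matrix_vector_mult_scaleR)
    then have "f x = of_real (lnorm x) powr \<rho> * f y" "f (k *v x) = of_real (lnorm x) powr \<rho> * f (k *v y)"
      using hom[OF yp(1) y(2)] hom[OF yp(2) y(2)] by simp_all
    ultimately show ?thesis by simp
  qed
  fix j :: 'q
  define e :: "'q option \<Rightarrow> real ^ 'q option" where "e i = axis i 1" for i
  have e: "norm (e a) = 1" "e (Some i) $ None = 0" "spatial (e (Some i)) = e (Some i)" "e None = base_point" for a i
    by (simp_all add: e_def spatial_def base_point_def) (simp_all add: axis_def)
  define g where "g s = f (base_point + s *\<^sub>R e (Some j))" for s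
  have ray_None: "(base_point + s *\<^sub>R e (Some j)) $ None = 1"
    and ray_spatial: "spatial (base_point + s *\<^sub>R e (Some j)) = s *\<^sub>R e (Some j)" for s
    by (simp_all add: e)
  have ray: "base_point + s *\<^sub>R e (Some j) \<in> forward_cone" if "\<bar>s\<bar> < 1" for s
    unfolding forward_cone_def mem_Collect_eq ray_None ray_spatial using that by (simp add: e)
  have radial: "f x = of_real (x $ None) powr \<rho> * g (norm (spatial x) / x $ None)" if x: "x \<in> forward_cone" for x
  proof -
    have x0: "x $ None > 0" "norm (spatial x) < x $ None"
      using x norm_ge_zero[of "spatial x"] unfolding forward_cone_def mem_Collect_eq by linarith+
    obtain k where k: "k \<in> stabilizer_K" "k *v spatial x = norm (spatial x) *\<^sub>R e (Some j)"
      using stabilizer_transitive[OF n, of "spatial x" "norm (spatial x) *\<^sub>R e (Some j)"] by (auto simp: e)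
    have "k *v x = k *v ((x $ None) *\<^sub>R base_point + spatial x)" by (metis spatial_decompose)
    also have "\<dots> = (x $ None) *\<^sub>R base_point + norm (spatial x) *\<^sub>R e (Some j)"
      by (simp add: matrix_vector_right_distrib matrix_vector_mult_scaleR k stabilizer_base_point)
    also have "\<dots> = (x $ None) *\<^sub>R (base_point + (norm (spatial x) / x $ None) *\<^sub>R e (Some j))"
      using x0 by (simp add: scaleR_right_distrib)
    finally have kx: "k *v x = (x $ None) *\<^sub>R (base_point + (norm (spatial x) / x $ None) *\<^sub>R e (Some j))" .
    have "f x = f (k *v x)" by (rule inv[OF k(1) x, symmetric])
    also have "\<dots> = of_real (x $ None) powr \<rho> * g (norm (spatial x) / x $ None)"
      unfolding kx g_def using x0 ray[of "norm (spatial x) / x $ None"]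
      by (intro hom) (auto simp: forward_cone_iff)
    finally show ?thesis .
  qed
  \<comment> \<open>The points of the ray with parameters s and -s have the same first coordinate
    and the same spatial norm, so the radial formula assigns them the same value.\<close>
  have even: "g (- s) = g s" if "\<bar>s\<bar> < 1" for s
    using radial[OF ray[OF that]] radial[OF ray[of "- s"]] that
    unfolding ray_None ray_spatial g_def[symmetric] by (simp add: e)
  obtain f' f'' where f': "\<And>x. x \<in> positive_cone \<Longrightarrow> (f has_derivative blinfun_apply (f' x)) (at x)"
    and f'': "\<And>x. x \<in> positive_cone \<Longrightarrow> (f' has_derivative blinfun_apply (f'' x)) (at x)"
    using f unfolding harmonic_space_def C2_on_def mem_Collect_eq by metis
  define R where "R s = base_point + s *\<^sub>R e (Some j)" for s
  define g' where "g' s = f' (R s) (e (Some j))" for s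
  define g'' where "g'' s = f'' (R s) (e (Some j)) (e (Some j))" for s
  have Rp: "R s \<in> positive_cone" if "\<bar>s\<bar> < 1" for s
    using ray[OF that] by (simp add: R_def forward_cone_iff)
  have dR: "(R has_derivative (\<lambda>t. t *\<^sub>R e (Some j))) (at s)" for s
    unfolding R_def by (auto intro!: derivative_eq_intros)
  have dg: "(g has_vector_derivative g' s) (at s)" if "\<bar>s\<bar> < 1" for s
    using has_derivative_compose[OF dR f'[OF Rp[OF that]]]
    unfolding has_vector_derivative_def g_def [abs_def] g'_def R_def[symmetric] by (simp add: blinfun.scaleR_right)
  have dg': "(g' has_vector_derivative g'' s) (at s)" if "\<bar>s\<bar> < 1" for s
  proof -
    have "((\<lambda>s. f' (R s)) has_derivative (\<lambda>t. f'' (R s) (t *\<^sub>R e (Some j)))) (at s)"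
      using has_derivative_compose[OF dR f''[OF Rp[OF that]]] .
    from bounded_linear.has_derivative[OF blinfun.bounded_linear_left this, of "e (Some j)"]
    show ?thesis
      unfolding has_vector_derivative_def g'_def [abs_def] g''_def
      by (simp add: blinfun.scaleR_right blinfun.scaleR_left)
  qed
  have "g' 0 = 0"
  proof -
    have "((\<lambda>s. g (- s)) has_vector_derivative - 1 *\<^sub>R g' 0) (at 0)"
      using dg[of 0] by (intro has_vector_derivative_chain_real) (auto intro!: derivative_eq_intros)
    then have "(g has_vector_derivative - 1 *\<^sub>R g' 0) (at 0)"
      by (rule has_vector_derivative_transform_within_open[of _ _ _ "{-1<..<1}"]) (auto simp: even)
    then have "- 1 *\<^sub>R g' 0 = g' 0"
      by (rule vector_derivative_unique_at) (simp add: dg)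
    then show ?thesis by simp
  qed
  moreover have "of_real (1 - s\<^sup>2) * g'' s = \<rho> * (\<rho> - 1) * g s - of_real (2 * s) * (\<rho> - 1) * g' s
      - of_real ((real CARD('q) - 1) / s) * g' s" if s: "0 < s" "s < 1" for s
  proof -
    have s1: "1 - s > 0" using s by simp
    have None: "partial_deriv None (partial_deriv None f) (R s)
      = \<rho> * (\<rho> - 1) * g s - of_real (2 * s) * (\<rho> - 1) * g' s + of_real (s\<^sup>2) * g'' s"
    proof (rule second_partial_deriv[OF s1 _ homogeneous_None_derivative[OF s dg dg', where \<rho> = \<rho>]])
      fix t assume t: "\<bar>t\<bar> < 1 - s"
      let ?y = "R s + t *\<^sub>R axis None 1"
      have y: "?y $ None = 1 + t" "spatial ?y = s *\<^sub>R e (Some j)"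
        by (simp_all add: R_def e flip: e_def)
      then have "?y \<in> forward_cone"
        unfolding forward_cone_def using s t by (simp add: e)
      from radial[OF this] show "f ?y = of_real (1 + t) powr \<rho> * g (s / (1 + t))"
        unfolding y using s by (simp add: e)
    qed auto
    have Same: "partial_deriv (Some j) (partial_deriv (Some j) f) (R s) = g'' s"
    proof (rule second_partial_deriv[OF s1, where \<phi> = "\<lambda>t. g (s + t)" and \<phi>' = "\<lambda>t. g' (s + t)"])
      fix t assume t: "\<bar>t\<bar> < 1 - s"
      show "f (R s + t *\<^sub>R axis (Some j) 1) = g (s + t)"
        by (simp add: R_def g_def e_def scaleR_left_distrib add.assoc)
      have "((\<lambda>t. g (s + t)) has_vector_derivative 1 *\<^sub>R g' (s + t)) (at t)"
        by (rule has_vector_derivative_chain_real)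
          (use s t in \<open>auto intro!: derivative_eq_intros dg\<close>)
      then show "((\<lambda>t. g (s + t)) has_vector_derivative g' (s + t)) (at t)" by simp
    next
      have "((\<lambda>t. g' (s + t)) has_vector_derivative 1 *\<^sub>R g'' s) (at 0)"
        by (rule has_vector_derivative_chain_real)
          (use s dg'[of s] in \<open>auto intro!: derivative_eq_intros\<close>)
      then show "((\<lambda>t. g' (s + t)) has_vector_derivative g'' s) (at 0)" by simp
    qed
    have Other: "partial_deriv (Some i) (partial_deriv (Some i) f) (R s) = of_real (1 / s) * g' s" if "i \<noteq> j" for i
    proof (rule second_partial_deriv[OF s1 _ radial_transversal_derivative[OF s dg dg']])
      fix t assume t: "\<bar>t\<bar> < 1 - s"
      let ?y = "R s + t *\<^sub>R axis (Some i) 1"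
      have orth: "orthogonal (s *\<^sub>R e (Some j)) (t *\<^sub>R e (Some i))"
        using that by (simp add: orthogonal_def e_def inner_axis_axis)
      have y: "?y $ None = 1" "spatial ?y = s *\<^sub>R e (Some j) + t *\<^sub>R e (Some i)"
        by (simp_all add: R_def e flip: e_def)
      have ny: "norm (spatial ?y) = sqrt (s\<^sup>2 + t\<^sup>2)"
        unfolding y using norm_add_Pythagorean[OF orth] by (simp add: e real_sqrt_unique[symmetric])
      have "sqrt (s\<^sup>2 + t\<^sup>2) \<le> \<bar>s\<bar> + \<bar>t\<bar>" by (rule sqrt_sum_squares_le_sum_abs)
      then have "?y \<in> forward_cone"
        unfolding forward_cone_def mem_Collect_eq ny y(1) using s t by linarith
      from radial[OF this] show "f ?y = g (sqrt (s\<^sup>2 + t\<^sup>2))"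
        unfolding ny y(1) by simp
    qed auto
    \<comment> \<open>One spatial axis runs along the ray and contributes g''; each of the q - 1
      others contributes g'(s) / s. Hence the coefficient m = q - 1.\<close>
    have "(\<Sum>i\<in>UNIV. partial_deriv (Some i) (partial_deriv (Some i) f) (R s))
        = g'' s + (\<Sum>i\<in>UNIV - {j}. of_real (1 / s) * g' s)"
      using Same Other by (subst sum.remove[of _ j]) auto
    also have "\<dots> = g'' s + of_real ((real CARD('q) - 1) / s) * g' s"
      using n by (simp add: card_Diff_singleton of_nat_diff)
    finally have "wave_op f (R s) = (\<rho> * (\<rho> - 1) * g s - of_real (2 * s) * (\<rho> - 1) * g' s + of_real (s\<^sup>2) * g'' s)
        - (g'' s + of_real ((real CARD('q) - 1) / s) * g' s)"
      unfolding wave_op_def None by simp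
    then have "(\<rho> * (\<rho> - 1) * g s - of_real (2 * s) * (\<rho> - 1) * g' s + of_real (s\<^sup>2) * g'' s)
        - (g'' s + of_real ((real CARD('q) - 1) / s) * g' s) = 0"
      using wave[OF Rp[of s]] s by simp
    then show ?thesis
      unfolding of_real_diff[of 1] of_real_1 by algebra
  qed
  ultimately have "radial_solution (real CARD('q) - 1) \<rho> g g' g''"
    unfolding radial_solution_def using dg dg' by blast
  moreover have "v x = of_real (x $ None) powr \<rho> * g (norm (spatial x) / x $ None)" if "x \<in> hyp_sphere" for x
    using vf[OF that] radial[OF subsetD[OF hyp_sphere_subset_forward_cone that]] by simp
  ultimately show thesis by (rule that)
qed

text \<open>The profile of v - a u solves the radial equation, and a = v(e) / u(e) makes it vanish
  at 0. On \<open>hyp_sphere\<close> the argument of the profile lies in [0, 1), where the energy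
  estimate applies.\<close>

lemma unique_K_spherical_functionI:
  fixes u :: "real ^ 'q::finite option \<Rightarrow> complex"
  assumes n: "CARD('q option) \<ge> 3" and u: "K_spherical_function \<rho> u" and u0: "u base_point \<noteq> 0"
  shows "unique_K_spherical_function \<rho> u"
proof -
  have "\<exists>a. \<forall>x\<in>hyp_sphere. v x = a * u x" if v: "K_spherical_function \<rho> v" for v
  proof (intro exI ballI)
    obtain g g' g'' where g: "radial_solution (real CARD('q) - 1) \<rho> g g' g''"
      and vg: "\<And>x. x \<in> hyp_sphere \<Longrightarrow> v x = of_real (x $ None) powr \<rho> * g (norm (spatial x) / x $ None)"
      using K_spherical_function_radial[OF n v] by metis
    obtain h h' h'' where h: "radial_solution (real CARD('q) - 1) \<rho> h h' h''"
      and uh: "\<And>x. x \<in> hyp_sphere \<Longrightarrow> u x = of_real (x $ None) powr \<rho> * h (norm (spatial x) / x $ None)"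
      using K_spherical_function_radial[OF n u] by metis
    define a where "a = v base_point / u base_point"
    have "g 0 - a * h 0 = 0"
      using vg[OF base_point_in_hyp_sphere] uh[OF base_point_in_hyp_sphere] u0
      by (simp add: a_def)
    fix x :: "real ^ 'q option" assume x: "x \<in> hyp_sphere"
    then have "norm (spatial x) < x $ None" "x $ None > 0"
      using hyp_sphere_subset_forward_cone by (auto simp: hyp_sphere_eq forward_cone_def)
    then have "0 \<le> norm (spatial x) / x $ None" "norm (spatial x) / x $ None < 1"
      by simp_all
    moreover have "real CARD('q) - 1 \<ge> 0" by (simp add: Suc_le_eq)
    ultimately have "g (norm (spatial x) / x $ None) - a * h (norm (spatial x) / x $ None) = 0"
      using radial_solution_zero[OF radial_solution_diff[OF g h]] \<open>g 0 - a * h 0 = 0\<close> by blast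
    then show "v x = a * u x" using vg[OF x] uh[OF x] by simp
  qed
  then show ?thesis
    using u u0 base_point_in_hyp_sphere unfolding unique_K_spherical_function_def by blast
qed

section \<open>Existence and uniqueness\<close>

text \<open>\<open>haar_measure_on\<close> states invariance for images, whereas
  \<open>distr\<close> is built on preimages. Surjectivity makes the image of a preimage the set
  itself, so invariance is applied to the preimage.\<close>

lemma distr_eq_selfI:
  assumes T: "T \<in> M \<rightarrow>\<^sub>M M" "T ` space M = space M"
    and inv: "\<And>A. A \<in> sets M \<Longrightarrow> emeasure M (T ` A) = emeasure M A"
  shows "distr M M T = M"
proof (rule measure_eqI)
  fix A assume "A \<in> sets (distr M M T)"
  then have A: "A \<in> sets M" by simp
  have "T ` (T -` A \<inter> space M) = A"
  proof (intro equalityI subsetI)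
    fix y assume y: "y \<in> A"
    then have "y \<in> T ` space M" using T(2) sets.sets_into_space[OF A] by auto
    then show "y \<in> T ` (T -` A \<inter> space M)" using y by auto
  qed auto
  then have "emeasure M (T -` A \<inter> space M) = emeasure M A"
    using inv[OF measurable_sets[OF T(1) A]] by simp
  then show "emeasure (distr M M T) A = emeasure M A"
    by (simp add: emeasure_distr T A)
qed simp

lemma unique_K_spherical_function_cong:
  fixes u w :: "real ^ 'q::finite option \<Rightarrow> complex"
  assumes "unique_K_spherical_function \<rho> u" and uw: "\<And>x. x \<in> hyp_sphere \<Longrightarrow> w x = u x"
  shows "unique_K_spherical_function \<rho> w"
proof -
  have "K_spherical_function \<rho> u" using assms(1) by (simp add: unique_K_spherical_function_def)
  then have "K_spherical_function \<rho> w"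
    using uw unfolding K_spherical_function_def spherical_harmonic_def K_invariant_def
    by (simp add: stabilizer_hyp_sphere)
  then show ?thesis
    using assms unfolding unique_K_spherical_function_def by simp
qed

lemma (in isotropic_family) unique_K_spherical_function_powr_integral:
  assumes n: "CARD('q option) \<ge> 3" and a: "a \<noteq> 0" and M: "emeasure M (space M) > 0"
    and T: "\<And>k. k \<in> stabilizer_K \<Longrightarrow> T k \<in> M \<rightarrow>\<^sub>M M"
    and surj: "\<And>k. k \<in> stabilizer_K \<Longrightarrow> T k ` space M = space M"
    and inv: "\<And>k A. k \<in> stabilizer_K \<Longrightarrow> A \<in> sets M \<Longrightarrow> emeasure M (T k ` A) = emeasure M A"
    and cT: "\<And>k \<omega>. k \<in> stabilizer_K \<Longrightarrow> \<omega> \<in> space M \<Longrightarrow> c (T k \<omega>) = k *v c \<omega>"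
  shows "unique_K_spherical_function \<rho> (powr_integral (\<lambda>_. a) \<rho>)"
proof (rule unique_K_spherical_functionI[OF n])
  show "K_spherical_function \<rho> (powr_integral (\<lambda>_. a) \<rho>)"
    unfolding K_spherical_function_def
    using T by (intro conjI spherical_harmonic_powr_integral K_invariant_powr_integral[of T] cT
        distr_eq_selfI surj inv)
  have "measure M (space M) \<noteq> 0" using M by (simp add: emeasure_eq_measure)
  then show "powr_integral (\<lambda>_. a) \<rho> base_point \<noteq> 0"
    using a \<gamma>_pos by (simp add: powr_integral_base_point)
qed

text \<open>A positive factor splits off a principal power. This reduces an isotropic c with
  negative first coordinate to -c, at the cost of a non-zero constant that becomes the weight of the
  integral.\<close>

lemma of_real_sign_powr:
  fixes \<rho> :: complex and \<epsilon> :: real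
  assumes "\<epsilon> = 1 \<or> \<epsilon> = - 1"
  obtains a where "a \<noteq> 0" "\<And>t. t > 0 \<Longrightarrow> of_real (\<epsilon> * t) powr \<rho> = a * of_real t powr \<rho>"
proof
  show "of_real \<epsilon> powr \<rho> \<noteq> 0" using assms by auto
  show "of_real (\<epsilon> * t) powr \<rho> = of_real \<epsilon> powr \<rho> * of_real t powr \<rho>" if "t > 0" for t
    using powr_times_real_left[of "of_real t" "of_real \<epsilon>" \<rho>] that assms by (auto simp: mult.commute)
qed

text \<open>\<open>K\<close> acts on itself by left translation, and mapping k to
  \<open>k *v d\<close> is equivariant for this action. Here d is c or -c, whichever has positive
  first coordinate.\<close>

lemma haar_integral_unique_K_spherical_function:
  fixes dk :: "(real ^ 'q::finite option ^ 'q option) measure" and \<rho> :: complex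
  assumes n: "CARD('q option) \<ge> 3" and dk: "haar_measure_on stabilizer_K dk"
    and c: "c \<noteq> 0" "isotropic c"
  shows "\<forall>x\<in>hyp_sphere. integrable dk (\<lambda>k. of_real (lprod (k *v c) x) powr \<rho> :: complex)"
    and "unique_K_spherical_function \<rho> (\<lambda>x. integral\<^sup>L dk (\<lambda>k. of_real (lprod (k *v c) x) powr \<rho>))"
proof -
  have sets: "sets dk = sets (restrict_space borel stabilizer_K)"
    using dk by (simp add: haar_measure_on_def)
  then have space: "space dk = stabilizer_K"
    using sets_eq_imp_space_eq[OF sets] by (simp add: space_restrict_space)
  have fin: "emeasure dk stabilizer_K < \<infinity>"
    using dk compact_stabilizer by (auto simp: haar_measure_on_def)
  have "openin (top_of_set stabilizer_K) (stabilizer_K :: (real ^ 'q option ^ 'q option) set)"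
    "(stabilizer_K :: (real ^ 'q option ^ 'q option) set) \<noteq> {}"
    using mat1_in_stabilizer by auto
  then have pos: "emeasure dk stabilizer_K > 0"
    using dk unfolding haar_measure_on_def by blast
  define \<epsilon> where "\<epsilon> = sgn (c $ None)"
  have \<epsilon>: "\<epsilon> = 1 \<or> \<epsilon> = - 1" "\<epsilon> * c $ None > 0" "\<epsilon> * \<epsilon> = 1"
    using isotropic_None_nonzero[OF c(2,1)] by (auto simp: \<epsilon>_def sgn_if)
  obtain a where a: "a \<noteq> 0" "\<And>t. t > 0 \<Longrightarrow> of_real (\<epsilon> * t) powr \<rho> = a * of_real t powr \<rho>"
    using of_real_sign_powr[OF \<epsilon>(1)] by metis
  define d where "d = \<epsilon> *\<^sub>R c"
  have "(\<lambda>k. k *v d) \<in> borel_measurable (restrict_space borel stabilizer_K)"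
    by (intro borel_measurable_continuous_on_restrict continuous_intros)
  then have meas: "(\<lambda>k. k *v d) \<in> borel_measurable dk"
    by (simp cong: measurable_cong_sets add: measurable_cong_sets[OF sets refl])
  interpret finite_measure dk
    by (rule finite_measureI) (use fin in \<open>simp add: space\<close>)
  interpret isotropic_family dk "\<lambda>k. k *v d" "\<epsilon> * c $ None"
  proof unfold_locales
    show "(\<lambda>k. k *v d) \<in> borel_measurable dk" by (rule meas)
    show "isotropic (k *v d)" if "k \<in> space dk" for k
      using that c by (simp add: space isotropic_def stabilizer_lprod d_def)
    show "(k *v d) $ None = \<epsilon> * c $ None" if "k \<in> space dk" for k
      using that by (simp add: space stabilizer_None d_def)
  qed (rule \<epsilon>(2))
  have integrand: "of_real (lprod (k *v c) x) powr \<rho> = a * of_real (lprod (k *v d) x) powr \<rho>"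
    if "x \<in> hyp_sphere" "k \<in> space dk" for k x
  proof -
    have "\<epsilon> * lprod (k *v d) x = \<epsilon> * \<epsilon> * lprod (k *v c) x"
      by (simp add: d_def matrix_vector_mult_scaleR)
    then have "lprod (k *v c) x = \<epsilon> * lprod (k *v d) x"
      by (simp add: \<epsilon>)
    then show ?thesis
      using a(2) lprod_c_pos that hyp_sphere_subset_forward_cone by (metis subsetD)
  qed
  show "\<forall>x\<in>hyp_sphere. integrable dk (\<lambda>k. of_real (lprod (k *v c) x) powr \<rho> :: complex)"
  proof
    fix x :: "real ^ 'q option" assume x: "x \<in> hyp_sphere"
    have "integrable dk (\<lambda>k. a * of_real (lprod (k *v d) x) powr \<rho>)"
      using x hyp_sphere_subset_forward_cone by (intro powr_integral_integrable bounded_weight_const) auto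
    then show "integrable dk (\<lambda>k. of_real (lprod (k *v c) x) powr \<rho> :: complex)"
      using integrand[OF x] by (simp cong: Bochner_Integration.integrable_cong)
  qed
  have "unique_K_spherical_function \<rho> (powr_integral (\<lambda>_. a) \<rho>)"
  proof (rule unique_K_spherical_function_powr_integral[where T="(**)", OF n a(1)])
    show "emeasure dk (space dk) > 0" using pos by (simp add: space)
    fix k :: "real ^ 'q option ^ 'q option" assume k: "k \<in> stabilizer_K"
    have "(**) k \<in> borel_measurable borel"
      unfolding matrix_matrix_mult_def
      by (intro borel_measurable_continuous_onI continuous_intros continuous_on_vec_lambda)
    then have "(**) k \<in> restrict_space borel stabilizer_K \<rightarrow>\<^sub>M restrict_space borel stabilizer_K"
      by (rule measurable_restrict_space3) (use stabilizer_mult[OF k] in auto)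
    then show "(**) k \<in> dk \<rightarrow>\<^sub>M dk"
      by (simp add: measurable_cong_sets[OF sets sets])
    \<comment> \<open>The transpose is the inverse within \<open>K\<close>, so left translation by k
      is onto.\<close>
    have "k' = k ** (transpose k ** k')" for k'
      by (simp add: matrix_mul_assoc stabilizer_transpose[OF k])
    then show "(**) k ` space dk = space dk"
      using stabilizer_mult[OF k] stabilizer_mult[OF stabilizer_transpose(1)[OF k]] unfolding space by blast
    show "emeasure dk ((**) k ` A) = emeasure dk A" if "A \<in> sets dk" for A
      using dk k that by (simp add: haar_measure_on_def)
    show "k ** \<omega> *v d = k *v (\<omega> *v d)" for \<omega> by (simp add: matrix_vector_mul_assoc)
  qed
  then show "unique_K_spherical_function \<rho> (\<lambda>x. integral\<^sup>L dk (\<lambda>k. of_real (lprod (k *v c) x) powr \<rho>))"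
    by (rule unique_K_spherical_function_cong)
      (simp add: powr_integral_def integrand cong: Bochner_Integration.integral_cong)
qed

text \<open>Invariance of Lebesgue measure under orthogonal maps is available for \<^typ>\<open>real ^ 'n\<close> with
  a well-ordered index type only; this copy of a finite type carries an arbitrary linear order.\<close>

typedef 'a ordered_copy = "UNIV :: 'a set" ..

instance ordered_copy :: (finite) finite
proof
  have "range (Rep_ordered_copy :: 'a ordered_copy \<Rightarrow> 'a) \<subseteq> UNIV" by simp
  then show "finite (UNIV :: 'a ordered_copy set)"
    by (metis Rep_ordered_copy_inject finite_code finite_imageD inj_onI)
qed

definition finite_rank :: "'a::finite \<Rightarrow> nat"
  where "finite_rank = (SOME f. inj f)"

lemma inj_finite_rank: "inj (finite_rank :: 'a::finite \<Rightarrow> nat)"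
proof -
  have "\<exists>f :: 'a \<Rightarrow> nat. inj f"
    using finite_imp_inj_to_nat_seg[of "UNIV :: 'a set"] by auto
  then show ?thesis unfolding finite_rank_def by (rule someI_ex)
qed

instantiation ordered_copy :: (finite) wellorder
begin

definition less_eq_ordered_copy :: "'a ordered_copy \<Rightarrow> 'a ordered_copy \<Rightarrow> bool"
  where "x \<le> y \<longleftrightarrow> finite_rank (Rep_ordered_copy x) \<le> finite_rank (Rep_ordered_copy y)"

definition less_ordered_copy :: "'a ordered_copy \<Rightarrow> 'a ordered_copy \<Rightarrow> bool"
  where "x < y \<longleftrightarrow> finite_rank (Rep_ordered_copy x) < finite_rank (Rep_ordered_copy y)"

instance
proof
  fix P and a :: "'a ordered_copy"
  assume step: "\<And>x :: 'a ordered_copy. (\<And>y. y < x \<Longrightarrow> P y) \<Longrightarrow> P x"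
  show "P a"
    by (induction a rule: measure_induct_rule[of "\<lambda>x. finite_rank (Rep_ordered_copy x)"])
      (rule step, simp add: less_ordered_copy_def)
next
  fix x y :: "'a ordered_copy"
  assume "x \<le> y" "y \<le> x"
  then have "finite_rank (Rep_ordered_copy x) = finite_rank (Rep_ordered_copy y)"
    by (simp add: less_eq_ordered_copy_def)
  then show "x = y"
    by (simp add: inj_eq[OF inj_finite_rank] Rep_ordered_copy_inject)
qed (auto simp: less_eq_ordered_copy_def less_ordered_copy_def)

end

definition of_copy :: "real ^ 'n::finite ordered_copy \<Rightarrow> real ^ 'n"
  where "of_copy y = (\<chi> i. y $ Abs_ordered_copy i)"

definition to_copy :: "real ^ 'n::finite \<Rightarrow> real ^ 'n ordered_copy"
  where "to_copy x = (\<chi> i. x $ Rep_ordered_copy i)"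

lemma of_copy_to_copy [simp]: "of_copy (to_copy x) = x" "to_copy (of_copy y) = y"
  by (simp_all add: of_copy_def to_copy_def vec_eq_iff Abs_ordered_copy_inverse Rep_ordered_copy_inverse)

lemma linear_of_copy: "linear of_copy"
  by (rule linearI) (simp_all add: of_copy_def vec_eq_iff)

lemma linear_to_copy: "linear to_copy"
  by (rule linearI) (simp_all add: to_copy_def vec_eq_iff)

lemma inner_to_copy: "to_copy x \<bullet> to_copy y = x \<bullet> y"
proof -
  have "bij (Rep_ordered_copy :: 'a ordered_copy \<Rightarrow> 'a)"
    by (rule bij_betw_byWitness[where f' = Abs_ordered_copy])
      (simp_all add: Rep_ordered_copy_inverse Abs_ordered_copy_inverse)
  then show ?thesis
    unfolding inner_vec_def to_copy_def
    using sum.reindex_bij_betw[of Rep_ordered_copy UNIV UNIV "\<lambda>i. x $ i \<bullet> y $ i"] by simp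
qed

lemma inner_of_copy: "of_copy x \<bullet> of_copy y = x \<bullet> y"
  using inner_to_copy[of "of_copy x" "of_copy y"] by simp

lemma norm_copy: "norm (to_copy x) = norm x" "norm (of_copy y) = norm y"
  by (simp_all add: norm_eq_sqrt_inner inner_to_copy inner_of_copy)

text \<open>Pushed forward along \<open>c\<close> below, Lebesgue measure becomes a
  rotation-invariant measure on the isotropic vectors with first coordinate 1, and so does the work
  of the average over \<open>K\<close>.\<close>

lemma exists_unique_K_spherical_function:
  assumes n: "CARD('q::finite option) \<ge> 3"
  shows "\<exists>u :: real ^ 'q option \<Rightarrow> complex. unique_K_spherical_function \<rho> u"
proof -
  define J :: "real ^ 'q option ordered_copy \<Rightarrow> real ^ 'q option" where "J = of_copy"
  define S :: "real ^ 'q option ordered_copy \<Rightarrow> real ^ 'q option" where "S y = spatial (J y)" for y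
  \<comment> \<open>Vectors without spatial part are left out because they have no spatial
    direction; the unit ball keeps the measure finite. \<open>K\<close> preserves both
    conditions.\<close>
  define \<Omega> where "\<Omega> = {y. norm y < 1 \<and> norm (S y) > 0}"
  define M where "M = restrict_space lborel \<Omega>"
  \<comment> \<open>The isotropic vector with first coordinate 1 in the spatial direction of y. It
    is equivariant because \<open>K\<close> fixes e, commutes with \<open>spatial\<close> and
    preserves norms.\<close>
  define c where "c y = base_point + (1 / norm (S y)) *\<^sub>R S y" for y
  define T where "T k y = to_copy (k *v J y)" for k :: "real ^ 'q option ^ 'q option" and y
  have JT: "J (T k y) = k *v J y" for k y by (simp add: J_def T_def)
  have contS: "continuous_on A S" for A
    unfolding S_def J_def
    by (intro linear_continuous_on_compose[OF _ linear_spatial] linear_continuous_on_compose[OF _ linear_of_copy]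
        continuous_on_id)
  have "open \<Omega>"
    unfolding \<Omega>_def by (intro open_Collect_conj open_Collect_less continuous_intros contS)
  then have \<Omega>: "\<Omega> \<in> sets borel" by simp
  have space: "space M = \<Omega>" by (simp add: M_def space_restrict_space)
  have sets: "sets M = sets (restrict_space borel \<Omega>)" by (simp add: M_def sets_restrict_space)
  have \<Omega>M: "\<Omega> \<in> sets M" using sets.top[of M] by (simp only: space)
  have emeasure_M: "emeasure M A = emeasure lborel A" if "A \<in> sets M" for A
    using that \<Omega> sets.sets_into_space[OF that] by (simp add: M_def emeasure_restrict_space space_restrict_space)
  have fin: "emeasure M \<Omega> < \<infinity>"
  proof -
    have "emeasure M \<Omega> = emeasure lborel \<Omega>" by (rule emeasure_M[OF \<Omega>M])
    also have "\<dots> \<le> emeasure lborel (ball 0 1 :: (real ^ 'q option ordered_copy) set)"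
      by (intro emeasure_mono) (auto simp: \<Omega>_def)
    also have "\<dots> < \<infinity>" using emeasure_bounded_finite bounded_ball by blast
    finally show ?thesis .
  qed
  have pos: "emeasure M \<Omega> > 0"
  proof -
    fix j :: 'q
    have "spatial ((1 / 2) *\<^sub>R axis (Some j) 1 :: real ^ 'q option) = (1 / 2) *\<^sub>R axis (Some j) 1"
      by (simp add: spatial_def) (simp add: axis_def)
    then have "to_copy ((1 / 2) *\<^sub>R axis (Some j) 1) \<in> \<Omega>"
      by (simp add: \<Omega>_def S_def J_def norm_copy)
    then have "\<not> negligible \<Omega>" using open_not_negligible[OF \<open>open \<Omega>\<close>] by auto
    then have "emeasure lborel \<Omega> \<noteq> 0"
      using \<Omega> by (auto simp: negligible_iff_null_sets null_sets_def)
    then show ?thesis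
      using emeasure_M[OF \<Omega>M] by (simp add: zero_less_iff_neq_zero)
  qed
  have T\<Omega>: "T k y \<in> \<Omega>" if k: "k \<in> stabilizer_K" and y: "y \<in> \<Omega>" for k y
  proof -
    have "norm (k *v x) = norm x" for x
      using orthogonal_transformation_norm[OF stabilizer_orthogonal[OF k]] .
    moreover have "norm (T k y) = norm y"
      using orthogonal_transformation_norm[OF stabilizer_orthogonal[OF k], of "J y"]
      by (simp add: T_def norm_copy) (simp add: J_def norm_copy)
    ultimately show ?thesis
      using y by (simp add: \<Omega>_def S_def JT stabilizer_spatial[OF k] del: zero_less_norm_iff)
  qed
  have linT: "linear (T k)" for k
    unfolding T_def J_def
    using linear_compose[OF linear_compose[OF linear_of_copy matrix_vector_mul_linear] linear_to_copy]
    by (simp add: o_def)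
  have measT: "T k \<in> M \<rightarrow>\<^sub>M M" if "k \<in> stabilizer_K" for k
  proof -
    have "T k \<in> borel_measurable borel"
      by (intro borel_measurable_continuous_onI linear_continuous_on linear_conv_bounded_linear[THEN iffD1] linT)
    then have "T k \<in> restrict_space borel \<Omega> \<rightarrow>\<^sub>M restrict_space borel \<Omega>"
      by (rule measurable_restrict_space3) (use T\<Omega>[OF that] in auto)
    then show ?thesis by (simp add: measurable_cong_sets[OF sets sets])
  qed
  have T_inv: "T k (T (transpose k) y) = y" "T (transpose k) (T k y) = y" if "k \<in> stabilizer_K" for k y
    using stabilizer_transpose(2,3)[OF that]
    by (simp_all add: T_def J_def matrix_vector_mul_assoc del: transpose_matrix_vector)
  interpret finite_measure M
    by (rule finite_measureI) (use fin in \<open>simp add: space\<close>)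
  interpret isotropic_family M c 1
  proof unfold_locales
    have "c \<in> borel_measurable (restrict_space borel \<Omega>)"
      unfolding c_def by (intro borel_measurable_continuous_on_restrict continuous_intros contS) (auto simp: \<Omega>_def)
    then show "c \<in> borel_measurable M" by (simp add: measurable_cong_sets[OF sets refl])
    fix y assume "y \<in> space M"
    then have "norm (S y) > 0" by (simp add: space \<Omega>_def)
    moreover have "spatial (S y) = S y" "S y $ None = 0" by (simp_all add: S_def)
    ultimately show "isotropic (c y)" "c y $ None = 1"
      by (simp_all add: isotropic_def lprod_self c_def)
  qed simp
  have "unique_K_spherical_function \<rho> (powr_integral (\<lambda>_. 1) \<rho>)"
  proof (rule unique_K_spherical_function_powr_integral[where T = T, OF n])
    show "emeasure M (space M) > 0" using pos by (simp add: space)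
    fix k :: "real ^ 'q option ^ 'q option" assume k: "k \<in> stabilizer_K"
    note k' = stabilizer_transpose(1)[OF k]
    show "T k \<in> M \<rightarrow>\<^sub>M M" by (rule measT[OF k])
    show "T k ` space M = space M"
      using T\<Omega>[OF k] T\<Omega>[OF k'] T_inv(1)[OF k] unfolding space
      by (metis (no_types, lifting) image_eqI image_subsetI subsetI subset_antisym)
    show "c (T k y) = k *v c y" if "y \<in> space M" for y
      using orthogonal_transformation_norm[OF stabilizer_orthogonal[OF k]]
      by (simp add: c_def S_def JT stabilizer_spatial[OF k] matrix_vector_right_distrib
          matrix_vector_mult_scaleR stabilizer_base_point[OF k])
    show "emeasure M (T k ` A) = emeasure M A" if A: "A \<in> sets M" for A
    proof -
      have A\<Omega>: "A \<subseteq> \<Omega>" using sets.sets_into_space[OF A] by (simp add: space)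
      \<comment> \<open>\<open>T (transpose k)\<close> inverts \<open>T k\<close>, so the image is a
        preimage under a measurable map and thus measurable.\<close>
      have "T k ` A = T (transpose k) -` A \<inter> space M"
      proof (intro equalityI subsetI)
        fix y assume "y \<in> T k ` A"
        then obtain x where "x \<in> A" "y = T k x" by blast
        then show "y \<in> T (transpose k) -` A \<inter> space M"
          using T\<Omega>[OF k subsetD[OF A\<Omega>]] by (simp add: space T_inv(2)[OF k])
      next
        fix y assume "y \<in> T (transpose k) -` A \<inter> space M"
        then have "T (transpose k) y \<in> A" by simp
        from imageI[OF this, of "T k"] show "y \<in> T k ` A" by (simp only: T_inv(1)[OF k])
      qed
      then have TA: "T k ` A \<in> sets M"
        using measurable_sets[OF measT[OF k'] A] by simp
      have borel: "B \<in> sets borel" if "B \<in> sets M" for B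
        using that \<Omega> by (auto simp: sets sets_restrict_space)
      \<comment> \<open>Invariance under orthogonal maps is applied to the real-valued measure of
        sets in \<open>lmeasurable\<close>, which requires finite measure. For Borel sets the result
        then passes from \<open>lebesgue\<close> back to \<open>lborel\<close>.\<close>
      have "emeasure lborel A \<le> emeasure lborel \<Omega>"
        using A\<Omega> \<Omega> by (intro emeasure_mono) auto
      also have "\<dots> < \<infinity>" using fin emeasure_M[OF \<Omega>M] by simp
      finally have lm: "A \<in> lmeasurable"
        using borel[OF A] by (auto simp: fmeasurable_def)
      have orth: "orthogonal_transformation (T k)"
        unfolding orthogonal_transformation_def
      proof safe
        fix x y
        have "(k *v J x) \<bullet> (k *v J y) = J x \<bullet> J y"
          using stabilizer_orthogonal[OF k] by (simp add: orthogonal_transformation_def)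
        also have "\<dots> = x \<bullet> y" by (simp add: J_def inner_of_copy)
        finally show "T k x \<bullet> T k y = x \<bullet> y" by (simp add: T_def inner_to_copy)
      qed (rule linT)
      have "emeasure lebesgue (T k ` A) = emeasure lebesgue A"
        using measurable_orthogonal_image[OF orth lm] measure_orthogonal_image[OF orth lm] lm
        by (simp add: emeasure_eq_measure2)
      then show ?thesis
        using borel[OF A] borel[OF TA] by (simp add: emeasure_M A TA)
    qed
  qed simp
  then show ?thesis by blast
qed

theorem corollary8:
  fixes \<rho> :: complex
  assumes "CARD('q::finite option) \<ge> 3"
  shows "(\<exists>u :: real ^ 'q option \<Rightarrow> complex. unique_K_spherical_function \<rho> u) \<and>
    (\<forall>(dk :: (real ^ 'q option ^ 'q option) measure) (c :: real ^ 'q option).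
      haar_measure_on stabilizer_K dk \<and> c \<noteq> 0 \<and> isotropic c \<longrightarrow>
        (\<forall>x\<in>hyp_sphere. integrable dk (\<lambda>k. of_real (lprod (k *v c) x) powr \<rho> :: complex)) \<and>
        unique_K_spherical_function \<rho>
          (\<lambda>x. integral\<^sup>L dk (\<lambda>k. of_real (lprod (k *v c) x) powr \<rho>)))"
  using exists_unique_K_spherical_function[OF assms]
    haar_integral_unique_K_spherical_function[OF assms] by blast

end
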